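(* Let $\mathscr{A}$ be an abelian category having enough projective objects, and let $\mathscr{T}$ be an additive subcategory of $\mathscr{A}$ which is closed under direct summands and contains all projective objects of $\mathscr{A}$. Then the following statements are equivalent. (1) $\mathscr{T}$ is resolving. (2) For any exact sequence $0 \to A_1 \to A_2 \to A_3 \to 0$ in $\mathscr{A}$, we have (i) $\mathscr{T}\text{-}\operatorname{pd} A_2\leq \max\{\mathscr{T}\text{-}\operatorname{pd} A_1,\mathscr{T}\text{-}\operatorname{pd} A_3\}$, with equality if $\mathscr{T}\text{-}\operatorname{pd} A_1+1\neq\mathscr{T}\text{-}\operatorname{pd} A_3$; (ii) $\mathscr{T}\text{-}\operatorname{pd} A_1\leq \max\{\mathscr{T}\text{-}\operatorname{pd} A_2,\mathscr{T}\text{-}\operatorname{pd} A_3-1\}$, with equality if $\mathscr{T}\text{-}\operatorname{pd} A_2\neq\mathscr{T}\text{-}\operatorname{pd} A_3$; (iii) $\mathscr{T}\text{-}\operatorname{pd} A_3\leq \max\{\mathscr{T}\text{-}\operatorname{pd} A_1+1,\mathscr{T}\text{-}\operatorname{pd} A_2\}$, with equality if $\mathscr{T}\text{-}\operatorname{pd} A_1\neq\mathscr{T}\text{-}\operatorname{pd} A_2$.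
   Context: All subcategories are full, additive and closed under isomorphisms and direct summands. For a subcategory $\mathscr{X}$ of $\mathscr{A}$ and $M\in\mathscr{A}$, the $\mathscr{X}$-projective dimension $\mathscr{X}\text{-}\operatorname{pd} M$ is the infimum of the integers $n\ge 0$ such that there is an exact sequence $0 \to X_n \to \cdots \to X_1\to X_0 \to M\to 0$ in $\mathscr{A}$ with all $X_i\in\mathscr{X}$, and $\mathscr{X}\text{-}\operatorname{pd} M=\infty$ if no such integer exists (with $\infty\pm 1=\infty$). A subcategory $\mathscr{T}$ is resolving if it contains all projective objects of $\mathscr{A}$ and is closed under extensions and kernels of epimorphisms. *)

theory Defs
  imports "HOL-Algebra.Group" "HOL-Library.Extended_Real"
begin

text \<open>The partial operations are total functions in the record; their values outside the intended
  domains (non-composable arrows, non-parallel arrows, non-objects) are unconstrained.\<close>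

record ('o, 'm) precat =
  Obj :: "'o set"
  Arr :: "'m set"
  Dom :: "'m \<Rightarrow> 'o"
  Cod :: "'m \<Rightarrow> 'o"
  Ident :: "'o \<Rightarrow> 'm"
  Comp :: "'m \<Rightarrow> 'm \<Rightarrow> 'm"  (infixr \<open>\<cdot>\<index>\<close> 70)
  Add :: "'m \<Rightarrow> 'm \<Rightarrow> 'm"  (infixl \<open>\<boxplus>\<index>\<close> 65)
  Zero :: "'o \<Rightarrow> 'o \<Rightarrow> 'm"

definition Hom :: "('o, 'm) precat \<Rightarrow> 'o \<Rightarrow> 'o \<Rightarrow> 'm set" where
  "Hom C A B = {f \<in> Arr C. Dom C f = A \<and> Cod C f = B}"

locale category =
  fixes C :: "('o, 'm) precat" (structure)
  assumes Dom_Obj: "f \<in> Arr C \<Longrightarrow> Dom C f \<in> Obj C"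
    and Cod_Obj: "f \<in> Arr C \<Longrightarrow> Cod C f \<in> Obj C"
    and Ident_Hom: "A \<in> Obj C \<Longrightarrow> Ident C A \<in> Hom C A A"
    and Comp_Hom: "f \<in> Hom C A B \<Longrightarrow> g \<in> Hom C B D \<Longrightarrow> g \<cdot> f \<in> Hom C A D"
    and Comp_assoc: "f \<in> Hom C A B \<Longrightarrow> g \<in> Hom C B D \<Longrightarrow> h \<in> Hom C D E \<Longrightarrow>
      (h \<cdot> g) \<cdot> f = h \<cdot> (g \<cdot> f)"
    and Comp_Ident_right: "f \<in> Hom C A B \<Longrightarrow> f \<cdot> Ident C A = f"
    and Comp_Ident_left: "f \<in> Hom C A B \<Longrightarrow> Ident C B \<cdot> f = f"

definition Hom_group :: "('o, 'm) precat \<Rightarrow> 'o \<Rightarrow> 'o \<Rightarrow> 'm monoid" where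
  "Hom_group C A B = \<lparr>carrier = Hom C A B, monoid.mult = Add C, one = Zero C A B\<rparr>"

locale preadditive_category = category +
  assumes Hom_comm_group: "A \<in> Obj C \<Longrightarrow> B \<in> Obj C \<Longrightarrow> comm_group (Hom_group C A B)"
    and Comp_Add_right: "f \<in> Hom C A B \<Longrightarrow> f' \<in> Hom C A B \<Longrightarrow> g \<in> Hom C B D \<Longrightarrow>
      g \<cdot> (f \<boxplus> f') = g \<cdot> f \<boxplus> g \<cdot> f'"
    and Comp_Add_left: "f \<in> Hom C A B \<Longrightarrow> g \<in> Hom C B D \<Longrightarrow> g' \<in> Hom C B D \<Longrightarrow>
      (g \<boxplus> g') \<cdot> f = g \<cdot> f \<boxplus> g' \<cdot> f"

definition is_mono :: "('o, 'm) precat \<Rightarrow> 'm \<Rightarrow> bool" where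
  "is_mono C f \<longleftrightarrow> f \<in> Arr C \<and>
    (\<forall>A. \<forall>g \<in> Hom C A (Dom C f). \<forall>h \<in> Hom C A (Dom C f).
      Comp C f g = Comp C f h \<longrightarrow> g = h)"

definition is_epi :: "('o, 'm) precat \<Rightarrow> 'm \<Rightarrow> bool" where
  "is_epi C f \<longleftrightarrow> f \<in> Arr C \<and>
    (\<forall>A. \<forall>g \<in> Hom C (Cod C f) A. \<forall>h \<in> Hom C (Cod C f) A.
      Comp C g f = Comp C h f \<longrightarrow> g = h)"

definition isomorphic :: "('o, 'm) precat \<Rightarrow> 'o \<Rightarrow> 'o \<Rightarrow> bool" where
  "isomorphic C A B \<longleftrightarrow> A \<in> Obj C \<and> B \<in> Obj C \<and>
    (\<exists>f \<in> Hom C A B. \<exists>g \<in> Hom C B A. Comp C g f = Ident C A \<and> Comp C f g = Ident C B)"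

definition zero_object :: "('o, 'm) precat \<Rightarrow> 'o \<Rightarrow> bool" where
  "zero_object C Z \<longleftrightarrow> Z \<in> Obj C \<and>
    (\<forall>A \<in> Obj C. (\<exists>!f. f \<in> Hom C Z A) \<and> (\<exists>!f. f \<in> Hom C A Z))"

definition biproduct :: "('o, 'm) precat \<Rightarrow> 'o \<Rightarrow> 'o \<Rightarrow> 'o \<Rightarrow> bool" where
  "biproduct C A B P \<longleftrightarrow> A \<in> Obj C \<and> B \<in> Obj C \<and> P \<in> Obj C \<and>
    (\<exists>i \<in> Hom C A P. \<exists>j \<in> Hom C B P. \<exists>p \<in> Hom C P A. \<exists>q \<in> Hom C P B.
      Comp C p i = Ident C A \<and> Comp C q j = Ident C B \<and>
      Comp C p j = Zero C B A \<and> Comp C q i = Zero C A B \<and>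
      Add C (Comp C i p) (Comp C j q) = Ident C P)"

definition is_kernel :: "('o, 'm) precat \<Rightarrow> 'm \<Rightarrow> 'm \<Rightarrow> bool" where
  "is_kernel C k f \<longleftrightarrow> k \<in> Arr C \<and> f \<in> Arr C \<and> Cod C k = Dom C f \<and>
    Comp C f k = Zero C (Dom C k) (Cod C f) \<and>
    (\<forall>A. \<forall>h \<in> Hom C A (Dom C f). Comp C f h = Zero C A (Cod C f) \<longrightarrow>
      (\<exists>!u. u \<in> Hom C A (Dom C k) \<and> Comp C k u = h))"

definition is_cokernel :: "('o, 'm) precat \<Rightarrow> 'm \<Rightarrow> 'm \<Rightarrow> bool" where
  "is_cokernel C c f \<longleftrightarrow> c \<in> Arr C \<and> f \<in> Arr C \<and> Dom C c = Cod C f \<and>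
    Comp C c f = Zero C (Dom C f) (Cod C c) \<and>
    (\<forall>A. \<forall>h \<in> Hom C (Cod C f) A. Comp C h f = Zero C (Dom C f) A \<longrightarrow>
      (\<exists>!u. u \<in> Hom C (Cod C c) A \<and> Comp C u c = h))"

locale abelian_category = preadditive_category +
  assumes ex_zero_object: "\<exists>Z. zero_object C Z"
    and ex_biproduct: "A \<in> Obj C \<Longrightarrow> B \<in> Obj C \<Longrightarrow> \<exists>P. biproduct C A B P"
    and ex_kernel: "f \<in> Arr C \<Longrightarrow> \<exists>k. is_kernel C k f"
    and ex_cokernel: "f \<in> Arr C \<Longrightarrow> \<exists>c. is_cokernel C c f"
    and mono_is_kernel: "is_mono C m \<Longrightarrow> \<exists>f. is_kernel C m f"
    and epi_is_cokernel: "is_epi C e \<Longrightarrow> \<exists>f. is_cokernel C e f"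

text \<open>The image of an arrow is the kernel of its cokernel.\<close>

definition is_image :: "('o, 'm) precat \<Rightarrow> 'm \<Rightarrow> 'm \<Rightarrow> bool" where
  "is_image C k f \<longleftrightarrow> (\<exists>c. is_cokernel C c f \<and> is_kernel C k c)"

definition exact_at :: "('o, 'm) precat \<Rightarrow> 'm \<Rightarrow> 'm \<Rightarrow> bool" where
  "exact_at C f g \<longleftrightarrow> f \<in> Arr C \<and> g \<in> Arr C \<and> Cod C f = Dom C g \<and>
    (\<exists>k. is_image C k f \<and> is_kernel C k g)"

text \<open>For a nonempty list of arrows \<open>[f\<^sub>1, \<dots>, f\<^sub>n]\<close>: exactness of
  \<open>0 \<rightarrow> Dom f\<^sub>1 \<rightarrow> \<dots> \<rightarrow> Cod f\<^sub>n \<rightarrow> 0\<close>, where the listed arrows are the inner ones, in the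
  order in which they are traversed.\<close>

definition exact_sequence :: "('o, 'm) precat \<Rightarrow> 'm list \<Rightarrow> bool" where
  "exact_sequence C fs \<longleftrightarrow> fs \<noteq> [] \<and>
    (\<exists>Z Z'. zero_object C Z \<and> zero_object C Z' \<and>
      successively (exact_at C) (Zero C Z (Dom C (hd fs)) # fs @ [Zero C (Cod C (last fs)) Z']))"

definition short_exact :: "('o, 'm) precat \<Rightarrow> 'o \<Rightarrow> 'm \<Rightarrow> 'o \<Rightarrow> 'm \<Rightarrow> 'o \<Rightarrow> bool" where
  "short_exact C A1 f A2 g A3 \<longleftrightarrow>
    f \<in> Hom C A1 A2 \<and> g \<in> Hom C A2 A3 \<and> exact_sequence C [f, g]"

definition projective :: "('o, 'm) precat \<Rightarrow> 'o \<Rightarrow> bool" where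
  "projective C P \<longleftrightarrow> P \<in> Obj C \<and>
    (\<forall>e. is_epi C e \<longrightarrow> (\<forall>f \<in> Hom C P (Cod C e). \<exists>h \<in> Hom C P (Dom C e). Comp C e h = f))"

definition enough_projectives :: "('o, 'm) precat \<Rightarrow> bool" where
  "enough_projectives C \<longleftrightarrow>
    (\<forall>A \<in> Obj C. \<exists>P e. projective C P \<and> e \<in> Hom C P A \<and> is_epi C e)"

text \<open>Full subcategories are represented by their sets of objects.\<close>

definition additive_subcategory :: "('o, 'm) precat \<Rightarrow> 'o set \<Rightarrow> bool" where
  "additive_subcategory C T \<longleftrightarrow> T \<subseteq> Obj C \<and>
    (\<forall>A B. A \<in> T \<and> isomorphic C A B \<longrightarrow> B \<in> T) \<and>
    (\<exists>Z \<in> T. zero_object C Z) \<and>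
    (\<forall>A B P. A \<in> T \<and> B \<in> T \<and> biproduct C A B P \<longrightarrow> P \<in> T)"

definition closed_under_summands :: "('o, 'm) precat \<Rightarrow> 'o set \<Rightarrow> bool" where
  "closed_under_summands C T \<longleftrightarrow>
    (\<forall>A B P. P \<in> T \<and> biproduct C A B P \<longrightarrow> A \<in> T \<and> B \<in> T)"

definition contains_projectives :: "('o, 'm) precat \<Rightarrow> 'o set \<Rightarrow> bool" where
  "contains_projectives C T \<longleftrightarrow> (\<forall>P. projective C P \<longrightarrow> P \<in> T)"

definition closed_under_extensions :: "('o, 'm) precat \<Rightarrow> 'o set \<Rightarrow> bool" where
  "closed_under_extensions C T \<longleftrightarrow>
    (\<forall>A1 A2 A3 f g. short_exact C A1 f A2 g A3 \<and> A1 \<in> T \<and> A3 \<in> T \<longrightarrow> A2 \<in> T)"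

definition closed_under_epi_kernels :: "('o, 'm) precat \<Rightarrow> 'o set \<Rightarrow> bool" where
  "closed_under_epi_kernels C T \<longleftrightarrow>
    (\<forall>e k. is_epi C e \<and> Dom C e \<in> T \<and> Cod C e \<in> T \<and> is_kernel C k e \<longrightarrow> Dom C k \<in> T)"

definition resolving :: "('o, 'm) precat \<Rightarrow> 'o set \<Rightarrow> bool" where
  "resolving C T \<longleftrightarrow> contains_projectives C T \<and>
    closed_under_extensions C T \<and> closed_under_epi_kernels C T"

text \<open>A list \<open>[d\<^sub>n, \<dots>, d\<^sub>0]\<close> of arrows such that \<open>0 \<rightarrow> X\<^sub>n \<rightarrow> \<dots> \<rightarrow> X\<^sub>0 \<rightarrow> M \<rightarrow> 0\<close> is exact,
  where \<open>X\<^sub>i = Dom d\<^sub>i \<in> X\<close>.\<close>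

definition resolution :: "('o, 'm) precat \<Rightarrow> 'o set \<Rightarrow> 'o \<Rightarrow> nat \<Rightarrow> 'm list \<Rightarrow> bool" where
  "resolution C X M n ds \<longleftrightarrow> length ds = Suc n \<and> exact_sequence C ds \<and>
    Cod C (last ds) = M \<and> (\<forall>d \<in> set ds. Dom C d \<in> X)"

text \<open>The values are extended reals, so that \<open>pd C X M - 1\<close> is an untruncated difference; the
  infimum of the empty set is \<open>\<infinity>\<close>, and \<open>\<infinity> + 1 = \<infinity> - 1 = \<infinity>\<close>.\<close>

definition pd :: "('o, 'm) precat \<Rightarrow> 'o set \<Rightarrow> 'o \<Rightarrow> ereal" where
  "pd C X M = Inf {ereal (real n) | n. \<exists>ds. resolution C X M n ds}"

end

theory Submission
  imports Defs
begin

text \<open>Let \<open>D\<^sub>n\<close> be the class of objects with a \<open>T\<close>-resolution of length \<open>n\<close>. Since the dimensions are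
  natural numbers or \<open>\<infinity>\<close>, all the (in)equalities follow from three statements about a short exact
  sequence \<open>0 \<rightarrow> A\<^sub>1 \<rightarrow> A\<^sub>2 \<rightarrow> A\<^sub>3 \<rightarrow> 0\<close>: if \<open>A\<^sub>1, A\<^sub>3 \<in> D\<^sub>n\<close> then \<open>A\<^sub>2 \<in> D\<^sub>n\<close>; if \<open>A\<^sub>2 \<in> D\<^sub>n\<close> and
  \<open>A\<^sub>3 \<in> D\<^sub>n\<^sub>+\<^sub>1\<close> then \<open>A\<^sub>1 \<in> D\<^sub>n\<close>; if \<open>A\<^sub>1 \<in> D\<^sub>n\<close> and \<open>A\<^sub>2 \<in> D\<^sub>n\<^sub>+\<^sub>1\<close> then \<open>A\<^sub>3 \<in> D\<^sub>n\<^sub>+\<^sub>1\<close>. They are proved by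
  induction on \<open>n\<close>, using the pullback of two epimorphisms and the kernel of a composite of two
  epimorphisms. Conversely, the class \<open>T\<close> consists of the objects of dimension at most \<open>0\<close>.\<close>

section \<open>Kernels and cokernels in a preadditive category\<close>

lemma HomI: "f \<in> Arr C \<Longrightarrow> Dom C f = A \<Longrightarrow> Cod C f = B \<Longrightarrow> f \<in> Hom C A B"
  by (simp add: Hom_def)

lemma Hom_Arr: "f \<in> Hom C A B \<Longrightarrow> f \<in> Arr C"
  and Hom_Dom: "f \<in> Hom C A B \<Longrightarrow> Dom C f = A"
  and Hom_Cod: "f \<in> Hom C A B \<Longrightarrow> Cod C f = B"
  by (simp_all add: Hom_def)

context category
begin

lemma Hom_Obj:
  assumes "f \<in> Hom C A B"
  shows "A \<in> Obj C" "B \<in> Obj C"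
  using assms Dom_Obj Cod_Obj by (auto simp: Hom_def)

lemma monoD:
  "is_mono C f \<Longrightarrow> f \<in> Hom C A B \<Longrightarrow> u \<in> Hom C W A \<Longrightarrow> v \<in> Hom C W A \<Longrightarrow> f \<cdot> u = f \<cdot> v \<Longrightarrow> u = v"
  by (auto simp: is_mono_def Hom_def)

lemma epiD:
  "is_epi C f \<Longrightarrow> f \<in> Hom C A B \<Longrightarrow> u \<in> Hom C B W \<Longrightarrow> v \<in> Hom C B W \<Longrightarrow> u \<cdot> f = v \<cdot> f \<Longrightarrow> u = v"
  by (auto simp: is_epi_def Hom_def)

lemma epi_Comp:
  assumes f: "f \<in> Hom C A B" "is_epi C f" and g: "g \<in> Hom C B D" "is_epi C g"
  shows "is_epi C (g \<cdot> f)"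
  unfolding is_epi_def
proof (intro conjI allI ballI impI)
  have gf: "g \<cdot> f \<in> Hom C A D" using f g Comp_Hom by blast
  then show "g \<cdot> f \<in> Arr C" by (rule Hom_Arr)
  fix W u v
  assume "u \<in> Hom C (Cod C (g \<cdot> f)) W" "v \<in> Hom C (Cod C (g \<cdot> f)) W"
  then have uv: "u \<in> Hom C D W" "v \<in> Hom C D W" using Hom_Cod[OF gf] by auto
  assume "u \<cdot> (g \<cdot> f) = v \<cdot> (g \<cdot> f)"
  then have "(u \<cdot> g) \<cdot> f = (v \<cdot> g) \<cdot> f" using Comp_assoc[OF f(1) g(1)] uv by simp
  then have "u \<cdot> g = v \<cdot> g"
    using epiD[OF f(2,1)] Comp_Hom[OF g(1)] uv by blast
  then show "u = v" using epiD[OF g(2,1)] uv by blast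
qed

lemma epi_of_Comp:
  assumes f: "f \<in> Hom C A B" and g: "g \<in> Hom C B D" and epi: "is_epi C (g \<cdot> f)"
  shows "is_epi C g"
  unfolding is_epi_def
proof (intro conjI allI ballI impI)
  show "g \<in> Arr C" using g by (rule Hom_Arr)
  have gf: "g \<cdot> f \<in> Hom C A D" using f g Comp_Hom by blast
  fix W u v
  assume "u \<in> Hom C (Cod C g) W" "v \<in> Hom C (Cod C g) W"
  then have uv: "u \<in> Hom C D W" "v \<in> Hom C D W" using Hom_Cod[OF g] by auto
  assume "u \<cdot> g = v \<cdot> g"
  then have "u \<cdot> (g \<cdot> f) = v \<cdot> (g \<cdot> f)"
    using Comp_assoc[OF f g uv(1)] Comp_assoc[OF f g uv(2)] by simp
  then show "u = v" using epiD[OF epi gf uv] by blast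
qed

lemma is_epi_Ident: "A \<in> Obj C \<Longrightarrow> is_epi C (Ident C A)"
  using Comp_Ident_right[of _ A] Ident_Hom[of A] by (auto simp: is_epi_def Hom_def)

lemma is_mono_Ident: "A \<in> Obj C \<Longrightarrow> is_mono C (Ident C A)"
  using Comp_Ident_left[of _ _ A] Ident_Hom[of A] by (auto simp: is_mono_def Hom_def)

text \<open>Monicity of \<open>k\<close> supplies the uniqueness half of the universal property, so
  only the existence of a factorization has to be checked.\<close>

lemma is_kernelI:
  assumes "k \<in> Hom C K A" "f \<in> Hom C A B" "f \<cdot> k = Zero C K B" "is_mono C k"
    and "\<And>W h. h \<in> Hom C W A \<Longrightarrow> f \<cdot> h = Zero C W B \<Longrightarrow> \<exists>u \<in> Hom C W K. k \<cdot> u = h"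
  shows "is_kernel C k f"
  unfolding is_kernel_def
proof (intro conjI allI ballI impI)
  fix W h
  assume "h \<in> Hom C W (Dom C f)" "f \<cdot> h = Zero C W (Cod C f)"
  then obtain u where "u \<in> Hom C W K" "k \<cdot> u = h"
    using assms(2,5) by (auto simp: Hom_def)
  then show "\<exists>!u. u \<in> Hom C W (Dom C k) \<and> k \<cdot> u = h"
    using monoD[OF assms(4,1)] assms(1) by (auto simp: Hom_def)
qed (use assms in \<open>auto simp: Hom_def\<close>)

end

context preadditive_category
begin

lemma Hom_group: "A \<in> Obj C \<Longrightarrow> B \<in> Obj C \<Longrightarrow> group (Hom_group C A B)"
  using Hom_comm_group by (simp add: comm_group_def)

lemma Zero_Hom: "A \<in> Obj C \<Longrightarrow> B \<in> Obj C \<Longrightarrow> Zero C A B \<in> Hom C A B"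
  using monoid.one_closed[OF group.is_monoid[OF Hom_group]] by (simp add: Hom_group_def)

lemma Add_Hom:
  assumes "f \<in> Hom C A B" "g \<in> Hom C A B"
  shows "f \<boxplus> g \<in> Hom C A B"
  using monoid.m_closed[OF group.is_monoid[OF Hom_group[OF Hom_Obj[OF assms(1)]]]] assms
  by (simp add: Hom_group_def)

lemma
  assumes "f \<in> Hom C A B"
  shows Add_Zero_left: "Zero C A B \<boxplus> f = f" and Add_Zero_right: "f \<boxplus> Zero C A B = f"
  using monoid.l_one[OF group.is_monoid[OF Hom_group[OF Hom_Obj[OF assms]]]]
    monoid.r_one[OF group.is_monoid[OF Hom_group[OF Hom_Obj[OF assms]]]] assms
  by (simp_all add: Hom_group_def)

lemma Add_right_cancel:
  assumes "f \<in> Hom C A B" "g \<in> Hom C A B" "h \<in> Hom C A B" "f \<boxplus> h = g \<boxplus> h"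
  shows "f = g"
  using group.right_cancel[OF Hom_group[OF Hom_Obj[OF assms(1)]], of h f g] assms
  by (simp add: Hom_group_def)

lemma ex_minus:
  assumes "f \<in> Hom C A B"
  shows "\<exists>f' \<in> Hom C A B. f \<boxplus> f' = Zero C A B"
  using group.r_inv_ex[OF Hom_group[OF Hom_Obj[OF assms]], of f] assms
  by (simp add: Hom_group_def)

text \<open>Bilinearity makes \<open>g \<cdot> Zero C A B\<close> equal to its own double;
  cancelling in the hom-group leaves zero.\<close>

lemma Comp_Zero_right:
  assumes g: "g \<in> Hom C B D" and A: "A \<in> Obj C"
  shows "g \<cdot> Zero C A B = Zero C A D"
proof -
  note B = Hom_Obj[OF g]
  have z: "Zero C A B \<in> Hom C A B" using Zero_Hom A B by blast
  have gz: "g \<cdot> Zero C A B \<in> Hom C A D" using Comp_Hom[OF z g] .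
  have "g \<cdot> Zero C A B \<boxplus> g \<cdot> Zero C A B = Zero C A D \<boxplus> g \<cdot> Zero C A B"
    using Comp_Add_right[OF z z g] Add_Zero_left[OF z] Add_Zero_left[OF gz] by simp
  then show ?thesis using Add_right_cancel[OF gz _ gz] Zero_Hom[of A D] A B by blast
qed

lemma Comp_Zero_left:
  assumes f: "f \<in> Hom C A B" and D: "D \<in> Obj C"
  shows "Zero C B D \<cdot> f = Zero C A D"
proof -
  note B = Hom_Obj[OF f]
  have z: "Zero C B D \<in> Hom C B D" using Zero_Hom D B by blast
  have fz: "Zero C B D \<cdot> f \<in> Hom C A D" using Comp_Hom[OF f z] .
  have "Zero C B D \<cdot> f \<boxplus> Zero C B D \<cdot> f = Zero C A D \<boxplus> Zero C B D \<cdot> f"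
    using Comp_Add_left[OF f z z] Add_Zero_left[OF z] Add_Zero_left[OF fz] by simp
  then show ?thesis using Add_right_cancel[OF fz _ fz] Zero_Hom[of A D] D B by blast
qed

text \<open>Cancellability only has to be tested against zero:
  \<open>u \<cdot> f = v \<cdot> f\<close> says that the difference of \<open>u\<close> and
  \<open>v\<close> kills \<open>f\<close>. In the proof \<open>v'\<close> is the negative of
  \<open>v\<close>.\<close>

lemma is_epi_iff:
  assumes f: "f \<in> Hom C A B"
  shows "is_epi C f \<longleftrightarrow> (\<forall>W. \<forall>u \<in> Hom C B W. u \<cdot> f = Zero C A W \<longrightarrow> u = Zero C B W)"
proof
  assume "is_epi C f"
  then show "\<forall>W. \<forall>u \<in> Hom C B W. u \<cdot> f = Zero C A W \<longrightarrow> u = Zero C B W"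
    using epiD[OF _ f] Comp_Zero_left[OF f] Zero_Hom Hom_Obj by metis
next
  assume H: "\<forall>W. \<forall>u \<in> Hom C B W. u \<cdot> f = Zero C A W \<longrightarrow> u = Zero C B W"
  show "is_epi C f"
    unfolding is_epi_def
  proof (intro conjI allI ballI impI)
    show "f \<in> Arr C" using f by (rule Hom_Arr)
    fix W u v
    assume "u \<in> Hom C (Cod C f) W" "v \<in> Hom C (Cod C f) W"
    then have uv: "u \<in> Hom C B W" "v \<in> Hom C B W" using Hom_Cod[OF f] by auto
    obtain v' where v': "v' \<in> Hom C B W" "v \<boxplus> v' = Zero C B W" using ex_minus[OF uv(2)] by blast
    assume "u \<cdot> f = v \<cdot> f"
    then have "(u \<boxplus> v') \<cdot> f = (v \<boxplus> v') \<cdot> f"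
      using Comp_Add_left[OF f uv(1) v'(1)] Comp_Add_left[OF f uv(2) v'(1)] by simp
    also have "\<dots> = Zero C A W" using v' Comp_Zero_left[OF f] Hom_Obj uv by metis
    finally have "u \<boxplus> v' = v \<boxplus> v'" using H Add_Hom[OF uv(1) v'(1)] v' by simp
    then show "u = v" using Add_right_cancel uv v' by blast
  qed
qed

lemma is_mono_iff:
  assumes f: "f \<in> Hom C A B"
  shows "is_mono C f \<longleftrightarrow> (\<forall>W. \<forall>u \<in> Hom C W A. f \<cdot> u = Zero C W B \<longrightarrow> u = Zero C W A)"
proof
  assume "is_mono C f"
  then show "\<forall>W. \<forall>u \<in> Hom C W A. f \<cdot> u = Zero C W B \<longrightarrow> u = Zero C W A"
    using monoD[OF _ f] Comp_Zero_right[OF f] Zero_Hom Hom_Obj by metis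
next
  assume H: "\<forall>W. \<forall>u \<in> Hom C W A. f \<cdot> u = Zero C W B \<longrightarrow> u = Zero C W A"
  show "is_mono C f"
    unfolding is_mono_def
  proof (intro conjI allI ballI impI)
    show "f \<in> Arr C" using f by (rule Hom_Arr)
    fix W u v
    assume "u \<in> Hom C W (Dom C f)" "v \<in> Hom C W (Dom C f)"
    then have uv: "u \<in> Hom C W A" "v \<in> Hom C W A" using Hom_Dom[OF f] by auto
    obtain v' where v': "v' \<in> Hom C W A" "v \<boxplus> v' = Zero C W A" using ex_minus[OF uv(2)] by blast
    assume "f \<cdot> u = f \<cdot> v"
    then have "f \<cdot> (u \<boxplus> v') = f \<cdot> (v \<boxplus> v')"
      using Comp_Add_right[OF uv(1) v'(1) f] Comp_Add_right[OF uv(2) v'(1) f] by simp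
    also have "\<dots> = Zero C W B" using v' Comp_Zero_right[OF f] Hom_Obj uv by metis
    finally have "u \<boxplus> v' = v \<boxplus> v'" using H Add_Hom[OF uv(1) v'(1)] v' by simp
    then show "u = v" using Add_right_cancel uv v' by blast
  qed
qed

lemma kernel_Hom:
  assumes "is_kernel C k f" "f \<in> Hom C A B"
  shows "k \<in> Hom C (Dom C k) A"
  using assms by (auto simp: is_kernel_def Hom_def)

lemma kernel_Comp:
  assumes "is_kernel C k f" "f \<in> Hom C A B" "k \<in> Hom C K A"
  shows "f \<cdot> k = Zero C K B"
  using assms by (auto simp: is_kernel_def Hom_def)

lemma kernel_factor:
  assumes "is_kernel C k f" "f \<in> Hom C A B" "k \<in> Hom C K A"
    and "h \<in> Hom C W A" "f \<cdot> h = Zero C W B"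
  shows "\<exists>u \<in> Hom C W K. k \<cdot> u = h"
  using assms unfolding is_kernel_def by (metis Hom_Dom Hom_Cod)

text \<open>If \<open>k \<cdot> u = k \<cdot> v\<close>, then \<open>u\<close> and \<open>v\<close>
  are two factorizations of the same arrow through the kernel, and these are unique.\<close>

lemma kernel_mono:
  assumes kf: "is_kernel C k f"
  shows "is_mono C k"
  unfolding is_mono_def
proof (intro conjI allI ballI impI)
  define K A B where "K = Dom C k" "A = Dom C f" "B = Cod C f"
  have f: "f \<in> Hom C A B" and k: "k \<in> Hom C K A"
    using kf by (auto simp: is_kernel_def Hom_def K_A_B_def)
  show "k \<in> Arr C" using k by (rule Hom_Arr)
  fix W u v
  assume u: "u \<in> Hom C W (Dom C k)" and v: "v \<in> Hom C W (Dom C k)" and eq: "k \<cdot> u = k \<cdot> v"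
  have ku: "k \<cdot> u \<in> Hom C W (Dom C f)" using Comp_Hom[OF _ k] u by (simp add: K_A_B_def)
  have "f \<cdot> (k \<cdot> u) = (f \<cdot> k) \<cdot> u" using Comp_assoc[OF _ k f] u by (simp add: K_A_B_def)
  also have "\<dots> = Zero C W (Cod C f)"
    using kernel_Comp[OF kf f k] Comp_Zero_left[OF u] Hom_Obj(2)[OF f] by (simp add: K_A_B_def)
  finally have "\<exists>!w. w \<in> Hom C W (Dom C k) \<and> k \<cdot> w = k \<cdot> u"
    using kf ku unfolding is_kernel_def by blast
  then show "u = v" using u v eq by metis
qed

lemma cokernel_Hom:
  assumes "is_cokernel C c f" "f \<in> Hom C A B"
  shows "c \<in> Hom C B (Cod C c)"
  using assms by (auto simp: is_cokernel_def Hom_def)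

lemma cokernel_Comp:
  assumes "is_cokernel C c f" "f \<in> Hom C A B" "c \<in> Hom C B D"
  shows "c \<cdot> f = Zero C A D"
  using assms by (auto simp: is_cokernel_def Hom_def)

lemma cokernel_factor:
  assumes "is_cokernel C c f" "f \<in> Hom C A B" "c \<in> Hom C B D"
    and "h \<in> Hom C B W" "h \<cdot> f = Zero C A W"
  shows "\<exists>u \<in> Hom C D W. u \<cdot> c = h"
  using assms unfolding is_cokernel_def by (metis Hom_Dom Hom_Cod)

text \<open>As \<open>k\<close> is mono, \<open>k \<cdot> d\<close> and \<open>d\<close> kill the
  same arrows, and a kernel depends only on which arrows are killed.\<close>

lemma is_kernel_mono_Comp:
  assumes k: "k \<in> Hom C B D" "is_mono C k" and d: "d \<in> Hom C A B"
  shows "is_kernel C j (k \<cdot> d) \<longleftrightarrow> is_kernel C j d"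
proof -
  have kd: "k \<cdot> d \<in> Hom C A D" using Comp_Hom k d by blast
  have eq: "(k \<cdot> d) \<cdot> h = Zero C W D \<longleftrightarrow> d \<cdot> h = Zero C W B" if h: "h \<in> Hom C W A" for h W
  proof -
    have "(k \<cdot> d) \<cdot> h = k \<cdot> (d \<cdot> h)" using Comp_assoc[OF h d k(1)] .
    moreover have "k \<cdot> Zero C W B = Zero C W D" using Comp_Zero_right[OF k(1)] Hom_Obj[OF h] by simp
    moreover have "d \<cdot> h \<in> Hom C W B" using Comp_Hom[OF h d] .
    ultimately show ?thesis using is_mono_iff[OF k(1)] k(2) by metis
  qed
  have Arrs: "k \<cdot> d \<in> Arr C" "d \<in> Arr C" "Dom C (k \<cdot> d) = A" "Dom C d = A"
    "Cod C (k \<cdot> d) = D" "Cod C d = B"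
    using kd d by (auto simp: Hom_def)
  have "(k \<cdot> d) \<cdot> j = Zero C (Dom C j) D \<longleftrightarrow> d \<cdot> j = Zero C (Dom C j) B"
    if "j \<in> Arr C" "Cod C j = A"
    using eq[OF HomI[OF that(1) refl that(2)]] .
  with eq show ?thesis
    unfolding is_kernel_def by (simp add: Arrs cong: conj_cong ball_cong)
qed

lemma is_kernel_Ident_Zero:
  assumes "A \<in> Obj C" "B \<in> Obj C"
  shows "is_kernel C (Ident C A) (Zero C A B)"
proof (rule is_kernelI)
  fix W h assume "h \<in> Hom C W A"
  then show "\<exists>u \<in> Hom C W A. Ident C A \<cdot> u = h" using Comp_Ident_left by blast
qed (use assms Ident_Hom Zero_Hom Comp_Ident_right[OF Zero_Hom] is_mono_Ident in auto)

lemma is_kernel_Zero_mono: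
  assumes m: "m \<in> Hom C A D" "is_mono C m" and Z: "zero_object C Z"
  shows "is_kernel C (Zero C Z A) m"
proof -
  have Zo: "Z \<in> Obj C" using Z by (simp add: zero_object_def)
  have z: "Zero C Z A \<in> Hom C Z A" using Zero_Hom[OF Zo] Hom_Obj[OF m(1)] by blast
  have unique: "u = v" if "u \<in> Hom C W Z" "v \<in> Hom C W Z" for W u v
    using Z that Hom_Obj[OF that(1)] unfolding zero_object_def by blast
  show ?thesis
  proof (rule is_kernelI[OF z m(1) Comp_Zero_right[OF m(1) Zo]])
    show "is_mono C (Zero C Z A)"
      unfolding is_mono_def Hom_Dom[OF z] using Hom_Arr[OF z] unique by blast
    fix W h assume h: "h \<in> Hom C W A" "m \<cdot> h = Zero C W D"
    then have "h = Zero C W A" using is_mono_iff[OF m(1)] m(2) by blast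
    moreover have "Zero C W Z \<in> Hom C W Z" using Zero_Hom Zo Hom_Obj[OF h(1)] by blast
    ultimately show "\<exists>u \<in> Hom C W Z. Zero C Z A \<cdot> u = h"
      using Comp_Zero_left Hom_Obj(1)[OF m(1)] by blast
  qed
qed

text \<open>An epi kernel \<open>d\<close> of \<open>f\<close> forces \<open>f\<close> to be zero,
  so the identity of \<open>B\<close> factors through \<open>d\<close>. This right inverse is
  two-sided because \<open>d\<close> is mono.\<close>

lemma isomorphic_if_epi_kernel:
  assumes d: "d \<in> Hom C A B" and epi: "is_epi C d" and ker: "is_kernel C d f"
  shows "isomorphic C A B"
proof -
  define D where "D = Cod C f"
  have f: "f \<in> Hom C B D" using ker d by (auto simp: is_kernel_def Hom_def D_def)
  note I = Ident_Hom Hom_Obj[OF d]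
  have "f = Zero C B D" using is_epi_iff[OF d] epi f kernel_Comp[OF ker f d] by blast
  then have "f \<cdot> Ident C B = Zero C B D" using Comp_Ident_right[OF f] by simp
  then obtain u where u: "u \<in> Hom C B A" "d \<cdot> u = Ident C B"
    using kernel_factor[OF ker f d] I by blast
  have "d \<cdot> (u \<cdot> d) = d \<cdot> Ident C A"
    using Comp_assoc[OF d u(1) d] u(2) Comp_Ident_left[OF d] Comp_Ident_right[OF d] by simp
  then have "u \<cdot> d = Ident C A"
    using monoD[OF kernel_mono[OF ker] d] Comp_Hom[OF d u(1)] I by blast
  then show ?thesis using u d I unfolding isomorphic_def by blast
qed

end

section \<open>Exactness\<close>

context abelian_category
begin

lemma ex_kernel_Hom:
  assumes "f \<in> Hom C A B"
  obtains k K where "k \<in> Hom C K A" "is_kernel C k f"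
  using ex_kernel[OF Hom_Arr[OF assms]] kernel_Hom[OF _ assms] by blast

lemma ex_cokernel_Hom:
  assumes "f \<in> Hom C A B"
  obtains c D where "c \<in> Hom C B D" "is_cokernel C c f"
  using ex_cokernel[OF Hom_Arr[OF assms]] cokernel_Hom[OF _ assms] by blast

lemma mono_is_kernel_Hom:
  assumes "m \<in> Hom C A B" "is_mono C m"
  obtains f D where "f \<in> Hom C B D" "is_kernel C m f"
proof -
  obtain f where f: "is_kernel C m f" using mono_is_kernel[OF assms(2)] by blast
  then have "f \<in> Hom C B (Cod C f)" using assms by (auto simp: is_kernel_def Hom_def)
  with f show thesis using that by blast
qed

text \<open>An epi is the cokernel of its own kernel: it is the cokernel of some \<open>f\<close>,
  and \<open>f\<close> factors through \<open>k\<close>, so an arrow that kills \<open>k\<close>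
  also kills \<open>f\<close>.\<close>

lemma epi_cokernel_factor:
  assumes e: "e \<in> Hom C A B" "is_epi C e" and k: "k \<in> Hom C K A" "is_kernel C k e"
    and h: "h \<in> Hom C A W" "h \<cdot> k = Zero C K W"
  shows "\<exists>u \<in> Hom C B W. u \<cdot> e = h"
proof -
  obtain f where cok: "is_cokernel C e f" using epi_is_cokernel[OF e(2)] by blast
  define D where "D = Dom C f"
  have f: "f \<in> Hom C D A" using cok e by (auto simp: is_cokernel_def Hom_def D_def)
  obtain u where u: "u \<in> Hom C D K" "k \<cdot> u = f"
    using kernel_factor[OF k(2) e(1) k(1) f] cokernel_Comp[OF cok f e(1)] by blast
  have "h \<cdot> f = (h \<cdot> k) \<cdot> u" using Comp_assoc[OF u(1) k(1) h(1)] u(2) by simp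
  also have "\<dots> = Zero C D W" using h Comp_Zero_left[OF u(1)] Hom_Obj by metis
  finally show ?thesis using cokernel_factor[OF cok f e(1) h(1)] by blast
qed

text \<open>Both sides say that the cokernel \<open>c\<close> of \<open>e\<close> is zero. Exactness
  makes the image \<open>k\<close> a kernel of a zero arrow, hence split epi, and
  \<open>c \<cdot> k\<close> is zero; conversely the identity of \<open>B\<close> serves as the
  image.\<close>

lemma exact_at_Zero_right:
  assumes e: "e \<in> Hom C A B" and Z: "Z \<in> Obj C"
  shows "exact_at C e (Zero C B Z) \<longleftrightarrow> is_epi C e"
proof
  note B = Hom_Obj[OF e]
  note z = Zero_Hom[OF B(2) Z]
  {
    assume "exact_at C e (Zero C B Z)"
    then obtain k c where cok: "is_cokernel C c e" and kc: "is_kernel C k c"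
      and kz: "is_kernel C k (Zero C B Z)"
      unfolding exact_at_def is_image_def by blast
    have c: "c \<in> Hom C B (Cod C c)" using cokernel_Hom[OF cok e] .
    have k: "k \<in> Hom C (Dom C k) B" using kernel_Hom[OF kc c] .
    obtain u where u: "u \<in> Hom C B (Dom C k)" "k \<cdot> u = Ident C B"
      using kernel_factor[OF kz z k Ident_Hom[OF B(2)]] Comp_Ident_right[OF z] by blast
    have "c = (c \<cdot> k) \<cdot> u" using Comp_assoc[OF u(1) k c] u(2) Comp_Ident_right[OF c] by simp
    also have "\<dots> = Zero C B (Cod C c)"
      using kernel_Comp[OF kc c k] Comp_Zero_left[OF u(1)] Hom_Obj[OF c] by simp
    finally have c0: "c = Zero C B (Cod C c)" .
    show "is_epi C e"
      unfolding is_epi_iff[OF e]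
    proof (intro allI ballI impI)
      fix W w assume w: "w \<in> Hom C B W" "w \<cdot> e = Zero C A W"
      then obtain v where "v \<in> Hom C (Cod C c) W" "v \<cdot> c = w"
        using cokernel_factor[OF cok e c] by blast
      then show "w = Zero C B W" using c0 Comp_Zero_right B by metis
    qed
  }
  {
    assume epi: "is_epi C e"
    obtain c D where c: "c \<in> Hom C B D" and cok: "is_cokernel C c e" using ex_cokernel_Hom[OF e] .
    have "c = Zero C B D" using is_epi_iff[OF e] epi c cokernel_Comp[OF cok e c] by blast
    then have "is_kernel C (Ident C B) c" using is_kernel_Ident_Zero Hom_Obj[OF c] by simp
    moreover have "is_kernel C (Ident C B) (Zero C B Z)" using is_kernel_Ident_Zero B Z by simp
    ultimately show "exact_at C e (Zero C B Z)"
      unfolding exact_at_def is_image_def using cok e z by (auto simp: Hom_def)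
  }
qed

text \<open>The cokernel of a zero arrow is split mono, so the image \<open>k\<close> of that arrow
  is zero. Exactness thus says that everything killed by \<open>g\<close> factors through
  zero.\<close>

lemma exact_at_Zero_left:
  assumes g: "g \<in> Hom C A B" and Z: "zero_object C Z"
  shows "exact_at C (Zero C Z A) g \<longleftrightarrow> is_mono C g"
proof
  note A = Hom_Obj[OF g]
  have Zo: "Z \<in> Obj C" using Z by (simp add: zero_object_def)
  note z = Zero_Hom[OF Zo A(1)]
  have Ident_A_Zero: "Ident C A \<cdot> Zero C Z A = Zero C Z A" using Comp_Ident_left[OF z] .
  {
    assume "exact_at C (Zero C Z A) g"
    then obtain k c where cok: "is_cokernel C c (Zero C Z A)" and kc: "is_kernel C k c"
      and kg: "is_kernel C k g"
      unfolding exact_at_def is_image_def by blast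
    have c: "c \<in> Hom C A (Cod C c)" using cokernel_Hom[OF cok z] .
    have k: "k \<in> Hom C (Dom C k) A" using kernel_Hom[OF kc c] .
    obtain u where u: "u \<in> Hom C (Cod C c) A" "u \<cdot> c = Ident C A"
      using cokernel_factor[OF cok z c Ident_Hom[OF A(1)] Ident_A_Zero] by blast
    have "k = u \<cdot> (c \<cdot> k)" using Comp_assoc[OF k c u(1)] u(2) Comp_Ident_left[OF k] by simp
    also have "\<dots> = Zero C (Dom C k) A"
      using kernel_Comp[OF kc c k] Comp_Zero_right[OF u(1)] Hom_Obj[OF k] by simp
    finally have k0: "k = Zero C (Dom C k) A" .
    show "is_mono C g"
      unfolding is_mono_iff[OF g]
    proof (intro allI ballI impI)
      fix W w assume w: "w \<in> Hom C W A" "g \<cdot> w = Zero C W B"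
      then obtain v where "v \<in> Hom C W (Dom C k)" "k \<cdot> v = w"
        using kernel_factor[OF kg g k] by blast
      then show "w = Zero C W A" using k0 Comp_Zero_left A by metis
    qed
  }
  {
    assume mono: "is_mono C g"
    have "\<exists>!u. u \<in> Hom C A W \<and> u \<cdot> Ident C A = h" if "h \<in> Hom C A W" for W h
      using that Comp_Ident_right by (intro ex1I[of _ h]) auto
    then have "is_cokernel C (Ident C A) (Zero C Z A)"
      using z Ident_Hom[OF A(1)] Ident_A_Zero
      by (simp add: is_cokernel_def Hom_Arr Hom_Dom[OF z] Hom_Cod[OF z]
          Hom_Dom[OF Ident_Hom[OF A(1)]] Hom_Cod[OF Ident_Hom[OF A(1)]])
    moreover have "is_kernel C (Zero C Z A) (Ident C A)"
      using is_kernel_Zero_mono[OF _ _ Z] Ident_Hom is_mono_Ident A by blast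
    moreover have "is_kernel C (Zero C Z A) g" using is_kernel_Zero_mono[OF g mono Z] .
    ultimately show "exact_at C (Zero C Z A) g"
      unfolding exact_at_def is_image_def using z g by (auto simp: Hom_def)
  }
qed

text \<open>Exactness in the middle is turned into surjectivity onto the kernel, which is what
  allows a long exact sequence to be cut into short ones.\<close>

lemma exact_at_kernel_Comp:
  assumes e: "e \<in> Hom C A B" and k: "k \<in> Hom C K A" and ker: "is_kernel C k e"
    and d: "d \<in> Hom C Y K"
  shows "exact_at C (k \<cdot> d) e \<longleftrightarrow> is_epi C d"
proof
  have kd: "k \<cdot> d \<in> Hom C Y A" using Comp_Hom[OF d k] .
  {
    assume "exact_at C (k \<cdot> d) e"
    then obtain j c where cok: "is_cokernel C c (k \<cdot> d)" and jc: "is_kernel C j c"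
      and je: "is_kernel C j e"
      unfolding exact_at_def is_image_def by blast
    have c: "c \<in> Hom C A (Cod C c)" using cokernel_Hom[OF cok kd] .
    have j: "j \<in> Hom C (Dom C j) A" using kernel_Hom[OF jc c] .
    obtain t where t: "t \<in> Hom C K (Dom C j)" "j \<cdot> t = k"
      using kernel_factor[OF je e j k kernel_Comp[OF ker e k]] by blast
    have "c \<cdot> k = (c \<cdot> j) \<cdot> t" using Comp_assoc[OF t(1) j c] t(2) by simp
    then have ck: "c \<cdot> k = Zero C K (Cod C c)"
      using kernel_Comp[OF jc c j] Comp_Zero_left[OF t(1)] Hom_Obj[OF c] by simp
    show "is_epi C d"
      unfolding is_epi_iff[OF d]
    proof (intro allI ballI impI)
      fix W w assume w: "w \<in> Hom C K W" "w \<cdot> d = Zero C Y W"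
      \<comment> \<open>The aim is to split the kernel \<open>m\<close> of \<open>w\<close>. The
        mono \<open>k \<cdot> m\<close> is a kernel of some \<open>f\<close>. Since \<open>d\<close>
        factors through \<open>m\<close>, \<open>f\<close> kills \<open>k \<cdot> d\<close> and so
        factors through \<open>c\<close>; as \<open>c\<close> kills \<open>k\<close>, so does
        \<open>f\<close>. Hence \<open>k\<close> factors through \<open>k \<cdot> m\<close>, which
        yields a right inverse \<open>r\<close> of \<open>m\<close>.\<close>
      obtain m M where m: "m \<in> Hom C M K" and mw: "is_kernel C m w" using ex_kernel_Hom[OF w(1)] .
      obtain s where s: "s \<in> Hom C Y M" "m \<cdot> s = d"
        using kernel_factor[OF mw w(1) m d w(2)] by blast
      have km: "k \<cdot> m \<in> Hom C M A" using Comp_Hom[OF m k] .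
      have "is_mono C (k \<cdot> m)"
        unfolding is_mono_iff[OF km]
      proof (intro allI ballI impI)
        fix V v assume v: "v \<in> Hom C V M" "(k \<cdot> m) \<cdot> v = Zero C V A"
        then have "k \<cdot> (m \<cdot> v) = Zero C V A" using Comp_assoc[OF v(1) m k] by simp
        then have "m \<cdot> v = Zero C V K"
          using is_mono_iff[OF k] kernel_mono[OF ker] Comp_Hom[OF v(1) m] by blast
        then show "v = Zero C V M" using is_mono_iff[OF m] kernel_mono[OF mw] v by blast
      qed
      then obtain f F where f: "f \<in> Hom C A F" and fk: "is_kernel C (k \<cdot> m) f"
        using mono_is_kernel_Hom[OF km] by blast
      have "f \<cdot> (k \<cdot> d) = (f \<cdot> (k \<cdot> m)) \<cdot> s"
        using Comp_assoc[OF s(1) km f] Comp_assoc[OF s(1) m k] s(2) by simp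
      also have "\<dots> = Zero C Y F"
        using kernel_Comp[OF fk f km] Comp_Zero_left[OF s(1)] Hom_Obj[OF f] by simp
      finally obtain v where v: "v \<in> Hom C (Cod C c) F" "v \<cdot> c = f"
        using cokernel_factor[OF cok kd c f] by blast
      have "f \<cdot> k = Zero C K F"
        using Comp_assoc[OF k c v(1)] v(2) ck Comp_Zero_right[OF v(1)] Hom_Obj[OF k] by simp
      then obtain r where r: "r \<in> Hom C K M" "(k \<cdot> m) \<cdot> r = k"
        using kernel_factor[OF fk f km k] by blast
      have "k \<cdot> (m \<cdot> r) = k \<cdot> Ident C K"
        using Comp_assoc[OF r(1) m k] r(2) Comp_Ident_right[OF k] by simp
      then have mr: "m \<cdot> r = Ident C K"
        using monoD[OF kernel_mono[OF ker] k] Comp_Hom[OF r(1) m] Ident_Hom Hom_Obj[OF k] by blast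
      have "w = (w \<cdot> m) \<cdot> r" using Comp_assoc[OF r(1) m w(1)] mr Comp_Ident_right[OF w(1)] by simp
      then show "w = Zero C K W"
        using kernel_Comp[OF mw w(1) m] Comp_Zero_left[OF r(1)] Hom_Obj[OF w(1)] by simp
    qed
  }
  {
    assume epi: "is_epi C d"
    obtain c D where c: "c \<in> Hom C A D" and cok: "is_cokernel C c (k \<cdot> d)"
      using ex_cokernel_Hom[OF kd] .
    have "(c \<cdot> k) \<cdot> d = Zero C Y D" using Comp_assoc[OF d k c] cokernel_Comp[OF cok kd c] by simp
    then have ck: "c \<cdot> k = Zero C K D" using is_epi_iff[OF d] epi Comp_Hom[OF k c] by blast
    have "e \<cdot> (k \<cdot> d) = Zero C Y B"
      using Comp_assoc[OF d k e] kernel_Comp[OF ker e k] Comp_Zero_left[OF d] Hom_Obj[OF e] by simp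
    then obtain v where v: "v \<in> Hom C D B" "v \<cdot> c = e"
      using cokernel_factor[OF cok kd c e] by blast
    \<comment> \<open>Since \<open>e\<close> factors through \<open>c\<close>, whatever
      \<open>c\<close> kills is killed by \<open>e\<close> and therefore factors through
      \<open>k\<close>.\<close>
    have "is_kernel C k c"
    proof (rule is_kernelI[OF k c ck kernel_mono[OF ker]])
      fix W h assume h: "h \<in> Hom C W A" "c \<cdot> h = Zero C W D"
      then have "e \<cdot> h = Zero C W B"
        using Comp_assoc[OF h(1) c v(1)] v(2) Comp_Zero_right[OF v(1)] Hom_Obj[OF h(1)] by simp
      then show "\<exists>u \<in> Hom C W K. k \<cdot> u = h" using kernel_factor[OF ker e k h(1)] by blast
    qed
    then show "exact_at C (k \<cdot> d) e"
      unfolding exact_at_def is_image_def using cok ker kd e by (auto simp: Hom_def)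
  }
qed

text \<open>The arrow \<open>f\<close> factors through its image, which is a kernel of
  \<open>e\<close>; so \<open>e\<close> kills \<open>f\<close>, and any other kernel
  \<open>k\<close> of \<open>e\<close> receives a factorization too.\<close>

lemma exact_at_factor:
  assumes ex: "exact_at C f e" and e: "e \<in> Hom C A B" and k: "k \<in> Hom C K A" "is_kernel C k e"
  obtains d where "d \<in> Hom C (Dom C f) K" "f = k \<cdot> d"
proof -
  obtain j c where cok: "is_cokernel C c f" and jc: "is_kernel C j c" and je: "is_kernel C j e"
    using ex unfolding exact_at_def is_image_def by blast
  have f: "f \<in> Hom C (Dom C f) A" using ex e by (auto simp: exact_at_def Hom_def)
  have c: "c \<in> Hom C A (Cod C c)" using cokernel_Hom[OF cok f] .
  have j: "j \<in> Hom C (Dom C j) A" using kernel_Hom[OF jc c] .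
  obtain u where u: "u \<in> Hom C (Dom C f) (Dom C j)" "j \<cdot> u = f"
    using kernel_factor[OF jc c j f cokernel_Comp[OF cok f c]] by blast
  have "e \<cdot> f = Zero C (Dom C f) B"
    using Comp_assoc[OF u(1) j e] u(2) kernel_Comp[OF je e j] Comp_Zero_left[OF u(1)]
      Hom_Obj[OF e] by simp
  then show thesis using kernel_factor[OF k(2) e k(1) f] that by blast
qed

lemma exact_at_mono_Comp:
  assumes "k \<in> Hom C B D" "is_mono C k" "d \<in> Hom C A B"
  shows "exact_at C f (k \<cdot> d) \<longleftrightarrow> exact_at C f d"
proof -
  have "k \<cdot> d \<in> Hom C A D" using Comp_Hom assms by blast
  then show ?thesis
    using is_kernel_mono_Comp[OF assms] assms(3) unfolding exact_at_def by (simp add: Hom_def)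
qed

text \<open>The end conditions are mono and epi. A mono is a kernel of some arrow, so it agrees with
  its image up to isomorphism, and middle exactness becomes the kernel property of \<open>f\<close>
  itself.\<close>

lemma short_exact_iff:
  "short_exact C A f B g D \<longleftrightarrow>
    f \<in> Hom C A B \<and> g \<in> Hom C B D \<and> is_kernel C f g \<and> is_epi C g"
proof (cases "f \<in> Hom C A B \<and> g \<in> Hom C B D")
  case True
  then have f: "f \<in> Hom C A B" and g: "g \<in> Hom C B D" by auto
  obtain Z where Z: "zero_object C Z" using ex_zero_object by blast
  have iff: "exact_sequence C [f, g] \<longleftrightarrow> is_mono C f \<and> exact_at C f g \<and> is_epi C g"
    using Z exact_at_Zero_left[OF f] exact_at_Zero_right[OF g] Hom_Dom[OF f] Hom_Cod[OF g]
    by (auto simp: exact_sequence_def zero_object_def)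
  have "is_mono C f \<and> exact_at C f g \<longleftrightarrow> is_kernel C f g"
  proof
    assume ker: "is_kernel C f g"
    have "exact_at C (f \<cdot> Ident C A) g"
      using exact_at_kernel_Comp[OF g f ker] Ident_Hom is_epi_Ident Hom_Obj[OF f] by blast
    then show "is_mono C f \<and> exact_at C f g"
      using Comp_Ident_right[OF f] kernel_mono[OF ker] by simp
  next
    assume H: "is_mono C f \<and> exact_at C f g"
    then obtain j c where cok: "is_cokernel C c f" and jc: "is_kernel C j c" and jg: "is_kernel C j g"
      unfolding exact_at_def is_image_def by blast
    have c: "c \<in> Hom C B (Cod C c)" using cokernel_Hom[OF cok f] .
    have j: "j \<in> Hom C (Dom C j) B" using kernel_Hom[OF jc c] .
    \<comment> \<open>\<open>h\<close> factors through the cokernel \<open>c\<close> of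
      \<open>f\<close>. An arrow killed by \<open>g\<close> factors through \<open>j\<close>, so it
      is killed by \<open>c\<close>, hence by \<open>h\<close>, and thus factors through
      \<open>f\<close>.\<close>
    obtain h H' where h: "h \<in> Hom C B H'" and fh: "is_kernel C f h"
      using mono_is_kernel_Hom[OF f] H by blast
    obtain v where v: "v \<in> Hom C (Cod C c) H'" "v \<cdot> c = h"
      using cokernel_factor[OF cok f c h kernel_Comp[OF fh h f]] by blast
    obtain u where u: "u \<in> Hom C A (Dom C j)" "j \<cdot> u = f"
      using kernel_factor[OF jc c j f cokernel_Comp[OF cok f c]] by blast
    show "is_kernel C f g"
    proof (rule is_kernelI[OF f g])
      show "g \<cdot> f = Zero C A D"
        using Comp_assoc[OF u(1) j g] u(2) kernel_Comp[OF jg g j] Comp_Zero_left[OF u(1)]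
          Hom_Obj[OF g] by simp
      show "is_mono C f" using H by simp
      fix W x assume x: "x \<in> Hom C W B" "g \<cdot> x = Zero C W D"
      then obtain y where y: "y \<in> Hom C W (Dom C j)" "j \<cdot> y = x"
        using kernel_factor[OF jg g j] by blast
      have "c \<cdot> x = Zero C W (Cod C c)"
        using Comp_assoc[OF y(1) j c] y(2) kernel_Comp[OF jc c j] Comp_Zero_left[OF y(1)]
          Hom_Obj[OF c] by simp
      then have "h \<cdot> x = Zero C W H'"
        using Comp_assoc[OF x(1) c v(1)] v(2) Comp_Zero_right[OF v(1)] Hom_Obj[OF x(1)] by simp
      then show "\<exists>u \<in> Hom C W A. f \<cdot> u = x" using kernel_factor[OF fh h f x(1)] by blast
    qed
  qed
  with iff True show ?thesis unfolding short_exact_def by blast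
qed (auto simp: short_exact_def)

section \<open>Pullbacks\<close>

text \<open>The four objects are existentially hidden: the arrows determine them, and exchanging the
  two legs becomes a permutation of arguments.\<close>

definition is_pullback :: "'b \<Rightarrow> 'b \<Rightarrow> 'b \<Rightarrow> 'b \<Rightarrow> bool" where
  "is_pullback b y g x \<longleftrightarrow> (\<exists>E B X D. b \<in> Hom C E B \<and> y \<in> Hom C E X \<and>
    g \<in> Hom C B D \<and> x \<in> Hom C X D \<and> g \<cdot> b = x \<cdot> y \<and>
    (\<forall>W. \<forall>s \<in> Hom C W B. \<forall>t \<in> Hom C W X. g \<cdot> s = x \<cdot> t \<longrightarrow>
      (\<exists>!w. w \<in> Hom C W E \<and> b \<cdot> w = s \<and> y \<cdot> w = t)))"

lemma is_pullback_sym: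
  assumes "is_pullback b y g x"
  shows "is_pullback y b x g"
proof -
  obtain E B X D where pb: "b \<in> Hom C E B" "y \<in> Hom C E X" "g \<in> Hom C B D" "x \<in> Hom C X D"
    "g \<cdot> b = x \<cdot> y"
    and univ: "\<And>W s t. s \<in> Hom C W B \<Longrightarrow> t \<in> Hom C W X \<Longrightarrow> g \<cdot> s = x \<cdot> t \<Longrightarrow>
      \<exists>!w. w \<in> Hom C W E \<and> b \<cdot> w = s \<and> y \<cdot> w = t"
    using assms unfolding is_pullback_def by blast
  have "\<exists>!w. w \<in> Hom C W E \<and> y \<cdot> w = t \<and> b \<cdot> w = s"
    if "t \<in> Hom C W X" "s \<in> Hom C W B" "x \<cdot> t = g \<cdot> s" for W s t
    using univ[OF that(2,1) that(3)[symmetric]] by blast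
  then show ?thesis
    unfolding is_pullback_def using pb(2,1,4,3) pb(5)[symmetric]
    by (intro exI[of _ E] exI[of _ X] exI[of _ B] exI[of _ D] conjI allI ballI impI)
qed

text \<open>Opposite sides of a pullback square have the same kernel object. As \<open>g\<close>
  kills \<open>a\<close>, the pair of \<open>a\<close> and the zero arrow induces \<open>a'\<close>,
  the kernel of \<open>y\<close>.\<close>

lemma pullback_kernel:
  assumes pb: "is_pullback b y g x" and a: "is_kernel C a g" "a \<in> Hom C A B"
    and y: "y \<in> Hom C E X"
  obtains a' where "a' \<in> Hom C A E" "is_kernel C a' y"
proof -
  obtain D where b: "b \<in> Hom C E B" and g: "g \<in> Hom C B D" and x: "x \<in> Hom C X D"
    and eq: "g \<cdot> b = x \<cdot> y"
    and univ: "\<And>W s t. s \<in> Hom C W B \<Longrightarrow> t \<in> Hom C W X \<Longrightarrow> g \<cdot> s = x \<cdot> t \<Longrightarrow>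
      \<exists>!w. w \<in> Hom C W E \<and> b \<cdot> w = s \<and> y \<cdot> w = t"
  proof -
    obtain E' B' X' D where *: "b \<in> Hom C E' B'" "y \<in> Hom C E' X'" "g \<in> Hom C B' D"
      "x \<in> Hom C X' D" "g \<cdot> b = x \<cdot> y"
      "\<And>W s t. s \<in> Hom C W B' \<Longrightarrow> t \<in> Hom C W X' \<Longrightarrow> g \<cdot> s = x \<cdot> t \<Longrightarrow>
        \<exists>!w. w \<in> Hom C W E' \<and> b \<cdot> w = s \<and> y \<cdot> w = t"
      using pb unfolding is_pullback_def by blast
    moreover have "E' = E" "X' = X" "B' = B"
      using * y a by (auto simp: Hom_def is_kernel_def)
    ultimately show thesis using that by blast
  qed
  have z: "Zero C A X \<in> Hom C A X" using Zero_Hom Hom_Obj[OF a(2)] Hom_Obj[OF y] by blast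
  have "g \<cdot> a = x \<cdot> Zero C A X"
    using kernel_Comp[OF a(1) g a(2)] Comp_Zero_right[OF x] Hom_Obj[OF a(2)] by simp
  then obtain a' where a': "a' \<in> Hom C A E" "b \<cdot> a' = a" "y \<cdot> a' = Zero C A X"
    using univ[OF a(2) z] by blast
  have "is_kernel C a' y"
  proof (rule is_kernelI[OF a'(1) y a'(3)])
    show "is_mono C a'"
      unfolding is_mono_iff[OF a'(1)]
    proof (intro allI ballI impI)
      fix W u assume u: "u \<in> Hom C W A" "a' \<cdot> u = Zero C W E"
      then have "a \<cdot> u = Zero C W B"
        using Comp_assoc[OF u(1) a'(1) b] a'(2) Comp_Zero_right[OF b] Hom_Obj[OF u(1)] by simp
      then show "u = Zero C W A" using is_mono_iff[OF a(2)] kernel_mono[OF a(1)] u by blast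
    qed
    fix W h assume h: "h \<in> Hom C W E" "y \<cdot> h = Zero C W X"
    have bh: "b \<cdot> h \<in> Hom C W B" using Comp_Hom[OF h(1) b] .
    have xz: "x \<cdot> (y \<cdot> h) = Zero C W D" using h Comp_Zero_right[OF x] Hom_Obj[OF h(1)] by simp
    then have "g \<cdot> (b \<cdot> h) = Zero C W D"
      using Comp_assoc[OF h(1) b g] Comp_assoc[OF h(1) y x] eq by simp
    then obtain u where u: "u \<in> Hom C W A" "a \<cdot> u = b \<cdot> h"
      using kernel_factor[OF a(1) g a(2) bh] by blast
    \<comment> \<open>\<open>a' \<cdot> u\<close> and \<open>h\<close> have the same two components,
      so the uniqueness clause of the pullback identifies them.\<close>
    have "a' \<cdot> u \<in> Hom C W E" using Comp_Hom[OF u(1) a'(1)] .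
    moreover have "b \<cdot> (a' \<cdot> u) = b \<cdot> h" using Comp_assoc[OF u(1) a'(1) b] a'(2) u(2) by simp
    moreover have "y \<cdot> (a' \<cdot> u) = y \<cdot> h"
      using Comp_assoc[OF u(1) a'(1) y] a'(3) Comp_Zero_left[OF u(1)] Hom_Obj[OF y] h(2) by simp
    moreover have "g \<cdot> (b \<cdot> h) = x \<cdot> (y \<cdot> h)" using \<open>g \<cdot> (b \<cdot> h) = Zero C W D\<close> xz by simp
    ultimately have "a' \<cdot> u = h" using univ[OF bh Comp_Hom[OF h(1) y]] h(1) by blast
    then show "\<exists>u \<in> Hom C W A. a' \<cdot> u = h" using u(1) by blast
  qed
  with a'(1) show thesis using that by blast
qed

text \<open>The pullback is the kernel of \<open>(g, -x) : B \<oplus> X \<rightarrow> D\<close>. As \<open>g\<close> is epi, so is this arrow, and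
  it is therefore the cokernel of its kernel; hence an arrow out of \<open>X\<close> that vanishes on the
  pullback factors through \<open>D\<close> by an arrow that vanishes on \<open>B\<close>.\<close>

lemma ex_pullback:
  assumes g: "g \<in> Hom C B D" and epi: "is_epi C g" and x: "x \<in> Hom C X D"
  obtains b y E where "b \<in> Hom C E B" "y \<in> Hom C E X" "is_pullback b y g x" "is_epi C y"
proof -
  note O = Hom_Obj[OF g] Hom_Obj[OF x]
  obtain P where "biproduct C B X P" using ex_biproduct O by blast
  then obtain i j p q where i: "i \<in> Hom C B P" and j: "j \<in> Hom C X P" and p: "p \<in> Hom C P B"
    and q: "q \<in> Hom C P X" and pi: "p \<cdot> i = Ident C B" and qj: "q \<cdot> j = Ident C X"
    and pj: "p \<cdot> j = Zero C X B" and qi: "q \<cdot> i = Zero C B X"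
    and ipjq: "i \<cdot> p \<boxplus> j \<cdot> q = Ident C P"
    unfolding biproduct_def by blast
  obtain x' where x': "x' \<in> Hom C X D" and xx': "x \<boxplus> x' = Zero C X D" using ex_minus[OF x] by blast
  have gp: "g \<cdot> p \<in> Hom C P D" and x'q: "x' \<cdot> q \<in> Hom C P D" using Comp_Hom g p x' q by blast+
  define \<phi> where "\<phi> = g \<cdot> p \<boxplus> x' \<cdot> q"
  have phi: "\<phi> \<in> Hom C P D" unfolding \<phi>_def using Add_Hom gp x'q by blast
  have phi_Comp: "\<phi> \<cdot> h = g \<cdot> (p \<cdot> h) \<boxplus> x' \<cdot> (q \<cdot> h)" if h: "h \<in> Hom C W P" for h W
    unfolding \<phi>_def using Comp_Add_left[OF h gp x'q] Comp_assoc[OF h p g] Comp_assoc[OF h q x'] by simp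
  have phi_i: "\<phi> \<cdot> i = g"
    using phi_Comp[OF i] pi qi Comp_Ident_right[OF g] Comp_Zero_right[OF x'] Add_Zero_right[OF g] O
    by simp
  have phi_epi: "is_epi C \<phi>" using epi_of_Comp[OF i phi] phi_i epi by simp
  obtain k E where k: "k \<in> Hom C E P" and ker: "is_kernel C k \<phi>" using ex_kernel_Hom[OF phi] .
  have b: "p \<cdot> k \<in> Hom C E B" and y: "q \<cdot> k \<in> Hom C E X" using Comp_Hom k p q by blast+
  \<comment> \<open>With \<open>x'\<close> the negative of \<open>x\<close>, a pair is killed by
    \<open>\<phi>\<close> exactly when it is compatible with \<open>g\<close> and
    \<open>x\<close>.\<close>
  have zero_iff: "g \<cdot> s \<boxplus> x' \<cdot> t = Zero C W D \<longleftrightarrow> g \<cdot> s = x \<cdot> t"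
    if s: "s \<in> Hom C W B" and t: "t \<in> Hom C W X" for W s t
  proof -
    have "x \<cdot> t \<boxplus> x' \<cdot> t = Zero C W D"
      using Comp_Add_left[OF t x x'] xx' Comp_Zero_left[OF t] O by simp
    moreover have "g \<cdot> s \<in> Hom C W D" "x \<cdot> t \<in> Hom C W D" "x' \<cdot> t \<in> Hom C W D"
      using Comp_Hom s t g x x' by blast+
    ultimately show ?thesis using Add_right_cancel by metis
  qed
  have "is_epi C (q \<cdot> k)"
    unfolding is_epi_iff[OF y]
  proof (intro allI ballI impI)
    fix W u assume u: "u \<in> Hom C X W" "u \<cdot> (q \<cdot> k) = Zero C E W"
    have uq: "u \<cdot> q \<in> Hom C P W" using Comp_Hom[OF q u(1)] .
    have "(u \<cdot> q) \<cdot> k = Zero C E W" using Comp_assoc[OF k q u(1)] u(2) by simp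
    then obtain v where v: "v \<in> Hom C D W" "v \<cdot> \<phi> = u \<cdot> q"
      using epi_cokernel_factor[OF phi phi_epi k ker uq] by blast
    have "v \<cdot> g = (u \<cdot> q) \<cdot> i" using Comp_assoc[OF i phi v(1)] phi_i v(2) by simp
    also have "\<dots> = Zero C B W"
      using Comp_assoc[OF i q u(1)] qi Comp_Zero_right[OF u(1)] O by simp
    finally have "v = Zero C D W" using is_epi_iff[OF g] epi v(1) by blast
    then have "u \<cdot> q = Zero C P W"
      using v(2) Comp_Zero_left[OF phi] Hom_Obj[OF u(1)] by simp
    then have "(u \<cdot> q) \<cdot> j = Zero C X W" using Comp_Zero_left[OF j] Hom_Obj[OF u(1)] by simp
    then show "u = Zero C X W" using Comp_assoc[OF j q u(1)] qj Comp_Ident_right[OF u(1)] by simp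
  qed
  moreover have "is_pullback (p \<cdot> k) (q \<cdot> k) g x"
    unfolding is_pullback_def
  proof (intro exI conjI allI ballI impI)
    show "g \<cdot> (p \<cdot> k) = x \<cdot> (q \<cdot> k)"
      using zero_iff[OF b y] phi_Comp[OF k] kernel_Comp[OF ker phi k] by simp
    fix W s t assume s: "s \<in> Hom C W B" and t: "t \<in> Hom C W X" and st: "g \<cdot> s = x \<cdot> t"
    have iB: "i \<cdot> s \<in> Hom C W P" and jX: "j \<cdot> t \<in> Hom C W P" using Comp_Hom s t i j by blast+
    define h where "h = i \<cdot> s \<boxplus> j \<cdot> t"
    have h: "h \<in> Hom C W P" unfolding h_def using Add_Hom[OF iB jX] .
    note W = Hom_Obj(1)[OF s]
    have ph: "p \<cdot> h = s"
      unfolding h_def Comp_Add_right[OF iB jX p]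
      using Comp_assoc[OF s i p] Comp_assoc[OF t j p] pi pj Comp_Ident_left[OF s]
        Comp_Zero_left[OF t] Add_Zero_right[OF s] O by simp
    have qh: "q \<cdot> h = t"
      unfolding h_def Comp_Add_right[OF iB jX q]
      using Comp_assoc[OF s i q] Comp_assoc[OF t j q] qi qj Comp_Ident_left[OF t]
        Comp_Zero_left[OF s] Add_Zero_left[OF t] O by simp
    \<comment> \<open>The decomposition of the identity of \<open>P\<close> recovers an arrow into
      the biproduct from its two components.\<close>
    have unique: "h' = h" if h': "h' \<in> Hom C W P" "p \<cdot> h' = s" "q \<cdot> h' = t" for h'
    proof -
      have "h' = (i \<cdot> p \<boxplus> j \<cdot> q) \<cdot> h'" using ipjq Comp_Ident_left[OF h'(1)] by simp
      also have "\<dots> = (i \<cdot> p) \<cdot> h' \<boxplus> (j \<cdot> q) \<cdot> h'"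
        using Comp_Add_left[OF h'(1) Comp_Hom[OF p i] Comp_Hom[OF q j]] .
      also have "\<dots> = h"
        unfolding h_def using Comp_assoc[OF h'(1) p i] Comp_assoc[OF h'(1) q j] h' by simp
      finally show ?thesis .
    qed
    have "\<phi> \<cdot> h = Zero C W D" using phi_Comp[OF h] ph qh zero_iff[OF s t] st by simp
    then obtain w where w: "w \<in> Hom C W E" "k \<cdot> w = h" using kernel_factor[OF ker phi k h] by blast
    show "\<exists>!w. w \<in> Hom C W E \<and> (p \<cdot> k) \<cdot> w = s \<and> (q \<cdot> k) \<cdot> w = t"
    proof (intro ex1I conjI)
      show "w \<in> Hom C W E" "(p \<cdot> k) \<cdot> w = s" "(q \<cdot> k) \<cdot> w = t"
        using w Comp_assoc[OF w(1) k p] Comp_assoc[OF w(1) k q] ph qh by auto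
      fix w' assume w': "w' \<in> Hom C W E \<and> (p \<cdot> k) \<cdot> w' = s \<and> (q \<cdot> k) \<cdot> w' = t"
      then have "k \<cdot> w' = h"
        using unique[OF Comp_Hom[OF _ k]] Comp_assoc[OF _ k p] Comp_assoc[OF _ k q] by auto
      then show "w' = w" using monoD[OF kernel_mono[OF ker] k] w w' by blast
    qed
  qed (use b y g x in auto)
  ultimately show thesis using that b y by blast
qed

text \<open>For the pullback built in \<open>ex_pullback\<close> this is known. Its leg
  \<open>y'\<close> factors through \<open>y\<close> by the universal property, so \<open>y\<close>
  is epi as well.\<close>

lemma pullback_epi:
  assumes pb: "is_pullback b y g x" and epi: "is_epi C g"
  shows "is_epi C y"
proof -
  obtain E B X D where b: "b \<in> Hom C E B" and y: "y \<in> Hom C E X" and g: "g \<in> Hom C B D"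
    and x: "x \<in> Hom C X D"
    and univ: "\<And>W s t. s \<in> Hom C W B \<Longrightarrow> t \<in> Hom C W X \<Longrightarrow> g \<cdot> s = x \<cdot> t \<Longrightarrow>
      \<exists>!w. w \<in> Hom C W E \<and> b \<cdot> w = s \<and> y \<cdot> w = t"
    using pb unfolding is_pullback_def by blast
  obtain b' y' E' where b': "b' \<in> Hom C E' B" and y': "y' \<in> Hom C E' X"
    and pb': "is_pullback b' y' g x" and epi': "is_epi C y'"
    using ex_pullback[OF g epi x] .
  have "g \<cdot> b' = x \<cdot> y'" using pb' unfolding is_pullback_def by blast
  then obtain w where "w \<in> Hom C E' E" "y \<cdot> w = y'" using univ[OF b' y'] by blast
  then show ?thesis using epi_of_Comp[OF _ y] epi' by blast
qed

section \<open>Short exact sequences up to the choice of arrows\<close>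

text \<open>Dimensions depend on objects only, so the later inductions need not carry the arrows
  along.\<close>

definition ses :: "'a \<Rightarrow> 'a \<Rightarrow> 'a \<Rightarrow> bool" where
  "ses A B D \<longleftrightarrow> (\<exists>k e. k \<in> Hom C A B \<and> e \<in> Hom C B D \<and> is_kernel C k e \<and> is_epi C e)"

lemma ses_iff_short_exact: "ses A B D \<longleftrightarrow> (\<exists>f g. short_exact C A f B g D)"
  by (simp add: ses_def short_exact_iff)

text \<open>\<open>E\<close> is the pullback of the two epis onto \<open>D\<close>; each projection
  is epi and inherits the kernel of the opposite side.\<close>

lemma ses_pullback:
  assumes "ses A B D" "ses K X D"
  obtains E where "ses K E B" "ses A E X"
proof -
  obtain a g where a: "a \<in> Hom C A B" "is_kernel C a g" and g: "g \<in> Hom C B D" "is_epi C g"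
    using assms(1) unfolding ses_def by blast
  obtain k x where k: "k \<in> Hom C K X" "is_kernel C k x" and x: "x \<in> Hom C X D" "is_epi C x"
    using assms(2) unfolding ses_def by blast
  obtain b y E where b: "b \<in> Hom C E B" and y: "y \<in> Hom C E X" and pb: "is_pullback b y g x"
    using ex_pullback[OF g x(1)] by blast
  note pb' = is_pullback_sym[OF pb]
  obtain a' where "a' \<in> Hom C A E" "is_kernel C a' y" using pullback_kernel[OF pb a(2,1) y] .
  moreover obtain k' where "k' \<in> Hom C K E" "is_kernel C k' b"
    using pullback_kernel[OF pb' k(2,1) b] .
  ultimately show thesis
    using that pullback_epi[OF pb g(2)] pullback_epi[OF pb' x(2)] b y unfolding ses_def by blast
qed

text \<open>The kernel of the composite of two epimorphisms \<open>Y \<rightarrow> E \<rightarrow> X\<close> is the pullback of \<open>Y \<rightarrow> E\<close>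
  along the kernel of \<open>E \<rightarrow> X\<close>.\<close>

lemma ses_Comp:
  assumes "ses L Y E" "ses A E X"
  obtains K where "ses K Y X" "ses L K A"
proof -
  obtain l e where l: "l \<in> Hom C L Y" "is_kernel C l e" and e: "e \<in> Hom C Y E" "is_epi C e"
    using assms(1) unfolding ses_def by blast
  obtain a g where a: "a \<in> Hom C A E" "is_kernel C a g" and g: "g \<in> Hom C E X" "is_epi C g"
    using assms(2) unfolding ses_def by blast
  have ge: "g \<cdot> e \<in> Hom C Y X" using Comp_Hom e g by blast
  obtain m K where m: "m \<in> Hom C K Y" and ker: "is_kernel C m (g \<cdot> e)" using ex_kernel_Hom[OF ge] .
  have em: "e \<cdot> m \<in> Hom C K E" using Comp_Hom[OF m e(1)] .
  have "g \<cdot> (e \<cdot> m) = Zero C K X" using Comp_assoc[OF m e(1) g(1)] kernel_Comp[OF ker ge m] by simp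
  then obtain r where r: "r \<in> Hom C K A" "a \<cdot> r = e \<cdot> m"
    using kernel_factor[OF a(2) g(1) a(1) em] by blast
  have pb: "is_pullback m r e a"
    unfolding is_pullback_def
  proof (intro exI conjI allI ballI impI)
    show "e \<cdot> m = a \<cdot> r" using r(2) by simp
    fix W s t assume s: "s \<in> Hom C W Y" and t: "t \<in> Hom C W A" and st: "e \<cdot> s = a \<cdot> t"
    have "(g \<cdot> e) \<cdot> s = (g \<cdot> a) \<cdot> t"
      using Comp_assoc[OF s e(1) g(1)] Comp_assoc[OF t a(1) g(1)] st by simp
    also have "\<dots> = Zero C W X"
      using kernel_Comp[OF a(2) g(1) a(1)] Comp_Zero_left[OF t] Hom_Obj[OF g(1)] by simp
    finally obtain w where w: "w \<in> Hom C W K" "m \<cdot> w = s"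
      using kernel_factor[OF ker ge m s] by blast
    have "a \<cdot> (r \<cdot> w) = a \<cdot> t"
      using Comp_assoc[OF w(1) r(1) a(1)] Comp_assoc[OF w(1) m e(1)] r(2) w(2) st by simp
    then have "r \<cdot> w = t" using monoD[OF kernel_mono[OF a(2)] a(1)] Comp_Hom[OF w(1) r(1)] t by blast
    with w show "\<exists>!w. w \<in> Hom C W K \<and> m \<cdot> w = s \<and> r \<cdot> w = t"
      using monoD[OF kernel_mono[OF ker] m] by blast
  qed (use m r e a in auto)
  obtain l' where "l' \<in> Hom C L K" "is_kernel C l' r" using pullback_kernel[OF pb l(2,1) r(1)] .
  then have "ses L K A" using r(1) pullback_epi[OF pb e(2)] unfolding ses_def by blast
  moreover have "ses K Y X" using m ker ge epi_Comp[OF e g] unfolding ses_def by blast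
  ultimately show thesis using that by blast
qed

lemma ses_Zero:
  assumes Z: "zero_object C Z" and A: "A \<in> Obj C"
  shows "ses Z A A"
proof -
  have "Zero C Z A \<in> Hom C Z A" using Z A Zero_Hom unfolding zero_object_def by blast
  then show ?thesis
    using is_kernel_Zero_mono[OF Ident_Hom[OF A] is_mono_Ident[OF A] Z] Ident_Hom[OF A]
      is_epi_Ident[OF A]
    unfolding ses_def by blast
qed

section \<open>Iterated syzygies\<close>

text \<open>A resolution cut into short exact sequences, with \<open>K\<close> as the first syzygy.
  The number is the length of some resolution, not the least such length.\<close>

fun has_dim :: "'a set \<Rightarrow> nat \<Rightarrow> 'a \<Rightarrow> bool" where
  "has_dim T 0 M \<longleftrightarrow> M \<in> T"
| "has_dim T (Suc n) M \<longleftrightarrow> (\<exists>K X. ses K X M \<and> X \<in> T \<and> has_dim T n K)"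

text \<open>The final zero arrow contributes only that the last arrow is epi; the remaining
  conditions concern the sequence without it.\<close>

lemma exact_sequence_snoc:
  assumes d: "d \<in> Hom C A B"
  shows "exact_sequence C (ds @ [d]) \<longleftrightarrow> is_epi C d \<and>
    (\<exists>Z. zero_object C Z \<and> successively (exact_at C) (Zero C Z (Dom C (hd (ds @ [d]))) # ds @ [d]))"
proof -
  have "exact_at C d (Zero C B Z) \<longleftrightarrow> is_epi C d" if "zero_object C Z" for Z
    using exact_at_Zero_right[OF d] that unfolding zero_object_def by blast
  moreover have "successively (exact_at C) (y # (ds @ [d]) @ [z]) \<longleftrightarrow>
      successively (exact_at C) (y # ds @ [d]) \<and> exact_at C d z" for y z
    using successively_append_iff[of "exact_at C" "y # ds @ [d]" "[z]"] by simp
  ultimately show ?thesis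
    unfolding exact_sequence_def by (auto simp: Hom_Cod[OF d] simp del: append_assoc)
qed

lemma exact_sequence_singleton:
  assumes d: "d \<in> Hom C A B"
  shows "exact_sequence C [d] \<longleftrightarrow> is_mono C d \<and> is_epi C d"
proof -
  have "exact_at C (Zero C Z A) d \<longleftrightarrow> is_mono C d" if "zero_object C Z" for Z
    using exact_at_Zero_left[OF d that] .
  then show ?thesis
    using exact_sequence_snoc[OF d, of "[]"] ex_zero_object Hom_Dom[OF d] by auto
qed

text \<open>Exactness at \<open>X\<close> amounts to \<open>d\<close> being epi, which is the end
  condition of the shorter sequence. Exactness at \<open>Y\<close> does not see the mono
  \<open>k\<close>, and the epi \<open>e\<close> provides the new end.\<close>

lemma exact_sequence_splice:
  assumes k: "k \<in> Hom C K X" "is_kernel C k e" and e: "e \<in> Hom C X M" "is_epi C e"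
    and d: "d \<in> Hom C Y K"
  shows "exact_sequence C (ds @ [k \<cdot> d, e]) \<longleftrightarrow> exact_sequence C (ds @ [d])"
proof -
  have kd: "k \<cdot> d \<in> Hom C Y X" using Comp_Hom[OF d k(1)] .
  have "Dom C (hd (ds @ [k \<cdot> d, e])) = Dom C (hd (ds @ [d]))"
    using Hom_Dom[OF kd] Hom_Dom[OF d] by (cases ds) auto
  moreover have "successively (exact_at C) (z # ds @ [k \<cdot> d, e]) \<longleftrightarrow>
      successively (exact_at C) (z # ds @ [d]) \<and> is_epi C d" for z
    using successively_append_iff[of "exact_at C" "z # ds" "[k \<cdot> d, e]"]
      successively_append_iff[of "exact_at C" "z # ds" "[d]"]
      exact_at_kernel_Comp[OF e(1) k d] exact_at_mono_Comp[OF k(1) kernel_mono[OF k(2)] d]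
    by auto
  ultimately show ?thesis
    using exact_sequence_snoc[OF e(1), of "ds @ [k \<cdot> d]"] exact_sequence_snoc[OF d, of ds] e(2)
    by auto
qed

text \<open>A resolution of length 0 is a single mono and epi arrow. A mono is a kernel here, so
  this arrow is an isomorphism, and \<open>T\<close> is closed under isomorphism.\<close>

lemma resolution_0_iff:
  assumes T: "additive_subcategory C T"
  shows "(\<exists>ds. resolution C T M 0 ds) \<longleftrightarrow> M \<in> T"
proof
  assume "\<exists>ds. resolution C T M 0 ds"
  then obtain d where d: "exact_sequence C [d]" "Cod C d = M" "Dom C d \<in> T"
    unfolding resolution_def by (auto simp: length_Suc_conv)
  then have dH: "d \<in> Hom C (Dom C d) M"
    unfolding exact_sequence_def by (auto simp: exact_at_def Hom_def)
  then have "is_mono C d" "is_epi C d" using d(1) exact_sequence_singleton by auto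
  then have "isomorphic C (Dom C d) M"
    using mono_is_kernel[of d] isomorphic_if_epi_kernel[OF dH] by blast
  then show "M \<in> T" using T d(3) unfolding additive_subcategory_def by blast
next
  assume M: "M \<in> T"
  then have "M \<in> Obj C" using T unfolding additive_subcategory_def by blast
  note I = Ident_Hom[OF this] is_mono_Ident[OF this] is_epi_Ident[OF this]
  have "resolution C T M 0 [Ident C M]"
    unfolding resolution_def using exact_sequence_singleton[OF I(1)] I M
    by (auto simp: Hom_def)
  then show "\<exists>ds. resolution C T M 0 ds" by blast
qed

text \<open>A resolution is cut at the kernel \<open>K\<close> of its last arrow \<open>e\<close>:
  the preceding arrow factors as \<open>k \<cdot> d\<close>, and \<open>d\<close> ends a resolution
  of \<open>K\<close>. Splicing reverses this.\<close>

lemma resolution_Suc_iff: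
  "(\<exists>ds. resolution C T M (Suc n) ds) \<longleftrightarrow>
    (\<exists>K X. ses K X M \<and> X \<in> T \<and> (\<exists>ds. resolution C T K n ds))"
proof
  assume "\<exists>ds. resolution C T M (Suc n) ds"
  then obtain ds' where ds': "resolution C T M (Suc n) ds'" by blast
  then obtain es e where es: "ds' = es @ [e]" "length es = Suc n"
    unfolding resolution_def by (metis length_Suc_conv_rev)
  then obtain ds f where ds: "es = ds @ [f]" "length ds = n"
    by (metis length_Suc_conv_rev)
  have ds'_eq: "ds' = ds @ [f, e]" using es ds by simp
  define X where "X = Dom C e"
  have ex: "exact_sequence C (ds @ [f, e])" and M: "Cod C e = M" and X: "X \<in> T"
    and f_T: "Dom C f \<in> T" and ds_T: "\<forall>d \<in> set ds. Dom C d \<in> T"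
    using ds' unfolding resolution_def ds'_eq X_def by auto
  obtain z z' where "successively (exact_at C) (z # (ds @ [f, e]) @ [z'])"
    using ex unfolding exact_sequence_def by blast
  then have fe: "exact_at C f e"
    using successively_append_iff[of "exact_at C" "z # ds" "[f, e, z']"] by auto
  have e: "e \<in> Hom C X M" using fe M by (auto simp: exact_at_def Hom_def X_def)
  have epi: "is_epi C e" using exact_sequence_snoc[OF e, of "ds @ [f]"] ex by simp
  obtain k K where k: "k \<in> Hom C K X" "is_kernel C k e" using ex_kernel_Hom[OF e] .
  obtain d where d: "d \<in> Hom C (Dom C f) K" "f = k \<cdot> d" using exact_at_factor[OF fe e k] .
  have "resolution C T K n (ds @ [d])"
    unfolding resolution_def
    using exact_sequence_splice[OF k e epi d(1), of ds] ex d f_T ds_T ds(2)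
    by (auto simp: Hom_def)
  moreover have "ses K X M" using k e epi unfolding ses_def by blast
  ultimately show "\<exists>K X. ses K X M \<and> X \<in> T \<and> (\<exists>ds. resolution C T K n ds)" using X by blast
next
  assume "\<exists>K X. ses K X M \<and> X \<in> T \<and> (\<exists>ds. resolution C T K n ds)"
  then obtain K X k e ds' where k: "k \<in> Hom C K X" "is_kernel C k e"
    and e: "e \<in> Hom C X M" "is_epi C e" and X: "X \<in> T" and ds': "resolution C T K n ds'"
    unfolding ses_def by blast
  obtain ds d where ds: "ds' = ds @ [d]" "length ds = n"
    using ds' unfolding resolution_def by (metis length_Suc_conv_rev)
  have ex: "exact_sequence C (ds @ [d])" and "Cod C d = K"
    using ds' unfolding resolution_def ds by auto
  \<comment> \<open>Exactness next to the closing zero arrow is what shows that \<open>d\<close> is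
    an arrow of the category.\<close>
  moreover obtain z z' where "successively (exact_at C) (z # (ds @ [d]) @ [z'])"
    using ex unfolding exact_sequence_def by blast
  then have "exact_at C d z'"
    using successively_append_iff[of "exact_at C" "z # ds" "[d, z']"] by auto
  ultimately have d: "d \<in> Hom C (Dom C d) K" by (auto simp: exact_at_def Hom_def)
  have "resolution C T M (Suc n) (ds @ [k \<cdot> d, e])"
    using exact_sequence_splice[OF k e d, of ds] ex ds ds' X Comp_Hom[OF d k(1)] e
    unfolding resolution_def by (auto simp: Hom_def)
  then show "\<exists>ds. resolution C T M (Suc n) ds" by blast
qed

lemma resolution_iff_has_dim:
  assumes "additive_subcategory C T"
  shows "(\<exists>ds. resolution C T M n ds) \<longleftrightarrow> has_dim T n M"
  by (induction n arbitrary: M) (simp_all add: resolution_0_iff[OF assms] resolution_Suc_iff)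

text \<open>A resolution is padded at its left end by a zero object, through the short exact
  sequence \<open>ses Z M M\<close> at the last syzygy.\<close>

lemma has_dim_mono:
  assumes T: "additive_subcategory C T" and M: "has_dim T m M" and "m \<le> n"
  shows "has_dim T n M"
  using \<open>m \<le> n\<close>
proof (induction n rule: dec_induct)
  case base
  show ?case using M .
next
  case (step n)
  obtain Z where Z: "zero_object C Z" "Z \<in> T" and "T \<subseteq> Obj C"
    using T unfolding additive_subcategory_def by blast
  have "has_dim T n M \<Longrightarrow> has_dim T (Suc n) M" for n M
  proof (induction n arbitrary: M)
    case 0
    then have "ses Z M M" "M \<in> T" using ses_Zero[OF Z(1)] \<open>T \<subseteq> Obj C\<close> by auto
    then show ?case using Z(2) by auto
  next
    case (Suc n)
    then obtain K X where K: "ses K X M" "X \<in> T" "has_dim T n K" by (auto simp only: has_dim.simps)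
    from K(3) have "has_dim T (Suc n) K" by (rule Suc.IH)
    with K show ?case using has_dim.simps(2)[of T "Suc n" M] by blast
  qed
  then show ?case using step by blast
qed

section \<open>From lengths of resolutions to values of the dimension\<close>

lemma pd_le_iff:
  assumes T: "additive_subcategory C T"
  shows "pd C T M \<le> ereal (real n) \<longleftrightarrow> has_dim T n M"
proof
  assume le: "pd C T M \<le> ereal (real n)"
  show "has_dim T n M"
  proof (rule ccontr)
    assume "\<not> has_dim T n M"
    \<comment> \<open>By monotonicity no resolution has length at most \<open>n\<close>, so the
      infimum is at least \<open>n + 1\<close>.\<close>
    then have "Suc n \<le> m" if "has_dim T m M" for m
      using has_dim_mono[OF T that, of n] by (meson not_less_eq_eq)
    then have "real (Suc n) \<le> real m" if "has_dim T m M" for m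
      using that of_nat_mono by blast
    then have "ereal (real (Suc n)) \<le> pd C T M"
      unfolding pd_def resolution_iff_has_dim[OF T] by (force intro!: Inf_greatest)
    with le show False using order.trans by fastforce
  qed
next
  assume "has_dim T n M"
  then show "pd C T M \<le> ereal (real n)"
    unfolding pd_def resolution_iff_has_dim[OF T] by (auto intro!: Inf_lower)
qed

text \<open>A nonempty set of naturals attains its infimum, and the empty set has infimum
  \<open>\<infinity>\<close>; negative and fractional values are thereby excluded.\<close>

lemma pd_cases:
  assumes T: "additive_subcategory C T"
  shows "pd C T M = \<infinity> \<or> (\<exists>n. pd C T M = ereal (real n))"
proof (cases "\<exists>n. has_dim T n M")
  case True
  define n where "n = (LEAST n. has_dim T n M)"
  have "has_dim T n M" using True unfolding n_def by (rule LeastI_ex)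
  moreover have "n \<le> m" if "has_dim T m M" for m unfolding n_def using that by (rule Least_le)
  ultimately have "pd C T M = ereal (real n)"
    unfolding pd_def resolution_iff_has_dim[OF T] by (auto intro!: antisym Inf_lower Inf_greatest)
  then show ?thesis by blast
next
  case False
  then have "pd C T M = \<infinity>"
    unfolding pd_def resolution_iff_has_dim[OF T] by (simp add: top_ereal_def)
  then show ?thesis by blast
qed

section \<open>Closure properties of dimension classes over a resolving subcategory\<close>

lemma resolving_ses_extension:
  "resolving C T \<Longrightarrow> ses A B D \<Longrightarrow> A \<in> T \<Longrightarrow> D \<in> T \<Longrightarrow> B \<in> T"
  unfolding resolving_def closed_under_extensions_def ses_iff_short_exact by blast

lemma resolving_ses_kernel:
  "resolving C T \<Longrightarrow> ses A B D \<Longrightarrow> B \<in> T \<Longrightarrow> D \<in> T \<Longrightarrow> A \<in> T"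
  unfolding resolving_def closed_under_epi_kernels_def ses_def
  by (metis Hom_Dom Hom_Cod)

lemma enough_projectives_ses:
  assumes "enough_projectives C" "contains_projectives C T" "M \<in> Obj C"
  obtains K P where "ses K P M" "P \<in> T"
proof -
  obtain P e where e: "projective C P" "e \<in> Hom C P M" "is_epi C e"
    using assms unfolding enough_projectives_def by blast
  obtain k K where "k \<in> Hom C K P" "is_kernel C k e" using ex_kernel_Hom[OF e(2)] .
  then show thesis using that e assms(2) unfolding contains_projectives_def ses_def by blast
qed

text \<open>Composing the cover \<open>Y\<close> of \<open>E\<close> with the epi onto
  \<open>X\<close> gives a kernel \<open>K\<close> in \<open>T\<close>. It covers \<open>A\<close>
  with the same syzygy \<open>L\<close> as that of \<open>E\<close>, so the length does not
  grow.\<close>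

lemma has_dim_kernel_to_subcategory:
  assumes res: "resolving C T" and A: "ses A E X" and "has_dim T n E" "X \<in> T"
  shows "has_dim T n A"
proof (cases n)
  case 0
  then show ?thesis using resolving_ses_kernel[OF res A] assms by simp
next
  case (Suc m)
  then obtain L Y where L: "ses L Y E" "Y \<in> T" "has_dim T m L" using assms by auto
  obtain K where K: "ses K Y X" "ses L K A" using ses_Comp[OF L(1) A] .
  then have "K \<in> T" using resolving_ses_kernel[OF res] L \<open>X \<in> T\<close> by blast
  then show ?thesis using K L Suc by auto
qed

context
  fixes T
  assumes enough: "enough_projectives C" and add: "additive_subcategory C T"
    and res: "resolving C T"
begin

text \<open>Closure under extensions and closure under kernels are proved by a simultaneous induction.
  Dimension \<open>n\<close> of the extension gives kernels of dimension \<open>n\<close> by a pullback; this yields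
  extensions of dimension \<open>n + 1\<close> by covering the middle term with a projective object.\<close>

lemma has_dim_kernel_if_extension:
  assumes ext: "\<And>A B D. ses A B D \<Longrightarrow> has_dim T n A \<Longrightarrow> has_dim T n D \<Longrightarrow> has_dim T n B"
    and S: "ses A B D" and B: "has_dim T n B" and D: "has_dim T (Suc n) D"
  shows "has_dim T n A"
proof -
  obtain K X where K: "ses K X D" "X \<in> T" "has_dim T n K" using D by auto
  \<comment> \<open>\<open>E\<close> is an extension of \<open>B\<close> by the syzygy
    \<open>K\<close> of \<open>D\<close>, and \<open>A\<close> is the kernel of an epi from
    \<open>E\<close> onto an object of \<open>T\<close>.\<close>
  obtain E where E: "ses K E B" "ses A E X" using ses_pullback[OF S K(1)] .
  have "has_dim T n E" using ext E(1) K(3) B by blast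
  then show ?thesis using has_dim_kernel_to_subcategory[OF res E(2)] K(2) by blast
qed

lemma has_dim_extension:
  "ses A B D \<Longrightarrow> has_dim T n A \<Longrightarrow> has_dim T n D \<Longrightarrow> has_dim T n B"
proof (induction n arbitrary: A B D)
  case 0
  then show ?case using resolving_ses_extension[OF res] by simp
next
  case (Suc n)
  have kernel: "has_dim T n A" if "ses A B D" "has_dim T n B" "has_dim T (Suc n) D" for A B D
    using has_dim_kernel_if_extension[OF _ that] Suc.IH by blast
  have "B \<in> Obj C" using Suc.prems(1) Hom_Obj unfolding ses_def by blast
  then obtain K P where K: "ses K P B" "P \<in> T"
    using enough_projectives_ses[OF enough] res unfolding resolving_def by blast
  \<comment> \<open>\<open>L\<close> is the kernel of
    \<open>P \<rightarrow> B \<rightarrow> D\<close>. The kernel statement applies first to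
    \<open>L\<close>, then to \<open>K\<close>, which is the kernel of an epi from \<open>L\<close>
    onto \<open>A\<close>.\<close>
  obtain L where L: "ses L P D" "ses K L A" using ses_Comp[OF K(1) Suc.prems(1)] .
  have "has_dim T n P" using has_dim_mono[OF add, of 0] K(2) by simp
  then have "has_dim T n L" using kernel L(1) Suc.prems(3) by blast
  then have "has_dim T n K" using kernel L(2) Suc.prems(2) by blast
  then show ?case using K by auto
qed

lemma has_dim_kernel:
  "ses A B D \<Longrightarrow> has_dim T n B \<Longrightarrow> has_dim T (Suc n) D \<Longrightarrow> has_dim T n A"
  using has_dim_kernel_if_extension has_dim_extension by blast

text \<open>The kernel \<open>L\<close> of \<open>X \<rightarrow> B \<rightarrow> D\<close> is an
  extension of \<open>A\<close> by the syzygy \<open>K\<close> of \<open>B\<close>, so it serves as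
  a syzygy of \<open>D\<close>.\<close>

lemma has_dim_cokernel:
  assumes S: "ses A B D" and A: "has_dim T n A" and B: "has_dim T (Suc n) B"
  shows "has_dim T (Suc n) D"
proof -
  obtain K X where K: "ses K X B" "X \<in> T" "has_dim T n K" using B by auto
  obtain L where L: "ses L X D" "ses K L A" using ses_Comp[OF K(1) S] .
  have "has_dim T n L" using has_dim_extension[OF L(2) K(3) A] .
  then show ?thesis using L K by auto
qed

end

end

section \<open>Arithmetic of the three dimensions and the equivalence\<close>

lemma max_relations_if_bounds:
  fixes a b c :: ereal
  assumes "a = \<infinity> \<or> (\<exists>n. a = ereal (real n))" "b = \<infinity> \<or> (\<exists>n. b = ereal (real n))"
    "c = \<infinity> \<or> (\<exists>n. c = ereal (real n))"
    and ab: "\<And>n. a \<le> ereal (real n) \<Longrightarrow> c \<le> ereal (real n) \<Longrightarrow> b \<le> ereal (real n)"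
    and ba: "\<And>n. b \<le> ereal (real n) \<Longrightarrow> c \<le> ereal (real (Suc n)) \<Longrightarrow> a \<le> ereal (real n)"
    and ca: "\<And>n. a \<le> ereal (real n) \<Longrightarrow> b \<le> ereal (real (Suc n)) \<Longrightarrow> c \<le> ereal (real (Suc n))"
  shows "(b \<le> max a c \<and> (a + 1 \<noteq> c \<longrightarrow> b = max a c)) \<and>
    (a \<le> max b (c - 1) \<and> (b \<noteq> c \<longrightarrow> a = max b (c - 1))) \<and>
    (c \<le> max (a + 1) b \<and> (a \<noteq> b \<longrightarrow> c = max (a + 1) b))"
proof -
  \<comment> \<open>The cases are sorted by which values are infinite; with two infinite values the
    relations hold outright.\<close>
  consider (abc) l m n where "a = ereal (real l)" "b = ereal (real m)" "c = ereal (real n)"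
    | (a) m n where "a = \<infinity>" "b = ereal (real m)" "c = ereal (real n)"
    | (b) l n where "a = ereal (real l)" "b = \<infinity>" "c = ereal (real n)"
    | (c) l m where "a = ereal (real l)" "b = ereal (real m)" "c = \<infinity>"
    | (ab) "a = \<infinity>" "b = \<infinity>"
    | (ac) "a = \<infinity>" "c = \<infinity>"
    | (bc) "b = \<infinity>" "c = \<infinity>"
    using assms(1-3) by blast
  then show ?thesis
  proof cases
    case abc
    \<comment> \<open>Each bound is used at the least threshold meeting its premises. Truncation in
      \<open>n - 1\<close> is harmless: \<open>n \<le> Suc (n - 1)\<close> also for
      \<open>n = 0\<close>, and the other entry of the maximum is nonnegative. The three
      inequalities together force the equalities.\<close>
    have "m \<le> max l n" using ab[of "max l n"] abc by simp
    moreover have "l \<le> max m (n - 1)" using ba[of "max m (n - 1)"] abc by simp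
    moreover have "n \<le> Suc (max l (m - 1))"
      using ca[of "max l (m - 1)"] unfolding abc ereal_less_eq of_nat_le_iff by simp
    ultimately show ?thesis using abc by (auto simp: one_ereal_def max_def split: if_splits)
  next
    \<comment> \<open>A single infinite value is contradictory: the two finite ones bound
      it.\<close>
    case a
    then show ?thesis using ba[of "max m n"] unfolding a ereal_less_eq of_nat_le_iff
      by (simp add: le_SucI)
  next
    case b
    then show ?thesis using ab[of "max l n"] by simp
  next
    case c
    then show ?thesis using ca[of "max l m"] unfolding c ereal_less_eq of_nat_le_iff
      by (simp add: le_SucI)
  next
    case ab
    then show ?thesis using assms(3) by (auto simp: one_ereal_def)
  next
    case ac
    then show ?thesis using assms(2) by (auto simp: one_ereal_def)
  next
    case bc
    then show ?thesis using assms(1) by (auto simp: one_ereal_def)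
  qed
qed

theorem theorem1p1:
  fixes C :: "('o, 'm) precat" and T :: "'o set"
  assumes "abelian_category C"
    and "enough_projectives C"
    and "additive_subcategory C T"
    and "closed_under_summands C T"
    and "contains_projectives C T"
  shows "resolving C T \<longleftrightarrow>
    (\<forall>A1 A2 A3 f g. short_exact C A1 f A2 g A3 \<longrightarrow>
      (pd C T A2 \<le> max (pd C T A1) (pd C T A3) \<and>
        (pd C T A1 + 1 \<noteq> pd C T A3 \<longrightarrow> pd C T A2 = max (pd C T A1) (pd C T A3))) \<and>
      (pd C T A1 \<le> max (pd C T A2) (pd C T A3 - 1) \<and>
        (pd C T A2 \<noteq> pd C T A3 \<longrightarrow> pd C T A1 = max (pd C T A2) (pd C T A3 - 1))) \<and>
      (pd C T A3 \<le> max (pd C T A1 + 1) (pd C T A2) \<and>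
        (pd C T A1 \<noteq> pd C T A2 \<longrightarrow> pd C T A3 = max (pd C T A1 + 1) (pd C T A2))))"
proof -
  interpret abelian_category C by (rule assms(1))
  note T = assms(3)
  show ?thesis (is "_ \<longleftrightarrow> ?relations")
  proof
    assume res: "resolving C T"
    show ?relations
    proof (intro allI impI, rule max_relations_if_bounds)
      fix A1 A2 A3 f g assume "short_exact C A1 f A2 g A3"
      then have S: "ses A1 A2 A3" using ses_iff_short_exact by blast
      fix n
      show "pd C T A1 \<le> ereal (real n) \<Longrightarrow> pd C T A3 \<le> ereal (real n) \<Longrightarrow>
          pd C T A2 \<le> ereal (real n)"
        unfolding pd_le_iff[OF T] using has_dim_extension[OF assms(2) T res S] .
      show "pd C T A2 \<le> ereal (real n) \<Longrightarrow> pd C T A3 \<le> ereal (real (Suc n)) \<Longrightarrow>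
          pd C T A1 \<le> ereal (real n)"
        unfolding pd_le_iff[OF T] using has_dim_kernel[OF assms(2) T res S] .
      show "pd C T A1 \<le> ereal (real n) \<Longrightarrow> pd C T A2 \<le> ereal (real (Suc n)) \<Longrightarrow>
          pd C T A3 \<le> ereal (real (Suc n))"
        unfolding pd_le_iff[OF T] using has_dim_cokernel[OF assms(2) T res S] .
    qed (rule pd_cases[OF T])+
  next
    assume rel: ?relations
    have in_T: "M \<in> T \<longleftrightarrow> pd C T M \<le> 0" for M
      using pd_le_iff[OF T, of M 0] by (simp add: zero_ereal_def)
    have "closed_under_extensions C T"
      unfolding closed_under_extensions_def in_T
    proof (intro allI impI, elim conjE)
      fix A1 A2 A3 f g assume "short_exact C A1 f A2 g A3"
      then have "pd C T A2 \<le> max (pd C T A1) (pd C T A3)" using rel by blast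
      also assume "pd C T A1 \<le> 0" "pd C T A3 \<le> 0"
      then have "max (pd C T A1) (pd C T A3) \<le> 0" by simp
      finally show "pd C T A2 \<le> 0" .
    qed
    moreover have "closed_under_epi_kernels C T"
      unfolding closed_under_epi_kernels_def
    proof (intro allI impI, elim conjE)
      fix e k assume e: "is_epi C e" "Dom C e \<in> T" "Cod C e \<in> T" and k: "is_kernel C k e"
      then have "e \<in> Hom C (Dom C e) (Cod C e)" by (simp add: is_epi_def Hom_def)
      then have "short_exact C (Dom C k) k (Dom C e) e (Cod C e)"
        using short_exact_iff kernel_Hom[OF k] k e by blast
      then have "pd C T (Dom C k) \<le> max (pd C T (Dom C e)) (pd C T (Cod C e) - 1)"
        using rel by blast
      also have "\<dots> \<le> 0"
      proof -
        \<comment> \<open>The difference is untruncated, so this entry of the maximum is at most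
          \<open>-1\<close>, and the bound 0 comes from \<open>Dom C e\<close>.\<close>
        have "pd C T (Cod C e) - 1 \<le> 0 - 1" using e in_T by (intro ereal_minus_mono) auto
        also have "\<dots> \<le> (0 :: ereal)" by (simp add: one_ereal_def zero_ereal_def)
        finally show ?thesis using e in_T by simp
      qed
      finally show "Dom C k \<in> T" using in_T by blast
    qed
    ultimately show "resolving C T" using assms(5) unfolding resolving_def by blast
  qed
qed

end
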